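(* Let $G=(V,E)$ be an (unsigned) graph with $|V|=n$, regarded as the signed graph with $\sigma\equiv+1$, with edge weight $w\equiv1$, vertex measure $\mu\equiv1$ and potential $\kappa\equiv0$. Then $(L_1,L_2,\dots,L_{n-1},L_n)=(0,0,\dots,0,C)$ for some $C>0$ if and only if $G$ is the disjoint union of a star graph on $4C^2+1$ vertices and $n-4C^2-1$ isolated vertices.
   Context: $G=(V,E)$ is a finite undirected graph without self-loops, $V=\{1,\dots,n\}$. A star graph on $m+1$ vertices ($m\ge1$) is the complete bipartite graph $K_{1,m}$. For $p\ge1$ and nonzero $f$, $\mathcal R_p(f)=\frac{\sum_{\{i,j\}\in E}|f(i)-f(j)|^p}{\sum_i|f(i)|^p}$; $\mathcal S_p=\{f:\sum_i|f(i)|^p=1\}$; Krasnoselskii genus $\gamma(B)$ of closed symmetric $B\subset\mathbb R^n\setminus\{0\}$: least $k$ with an odd continuous map $B\to\mathbb R^k\setminus\{0\}$; $\mathcal F_k(\mathcal S_p)$ = closed symmetric $B\subset\mathcal S_p$ with $\gamma(B)\ge k$; $\lambda_k^{(p)}=\min_{B\in\mathcal F_k(\mathcal S_p)}\max_{f\in B}\mathcal R_p(f)$. Cut-off adjacency eigenvalues: $L_k:=\lim_{p\to\infty}2^{-p}\lambda_k^{(p)}$ (the limits exist). *)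

theory Defs
  imports "HOL-Analysis.Analysis"
begin

text \<open>Graphs on the finite vertex type 'n (with n = CARD('n)) are given by a set E of
ordered pairs that is symmetric and irreflexive; the unordered edge {i,j} corresponds
to the two pairs (i,j),(j,i). Functions on vertices are vectors in real^'n.\<close>

definition simple_graph :: "('n::finite \<times> 'n) set \<Rightarrow> bool" where
  "simple_graph E \<longleftrightarrow> sym E \<and> irrefl E"

text \<open>p-Rayleigh quotient; the sum over unordered edges equals half the sum over ordered pairs.\<close>
definition rayleigh :: "('n::finite \<times> 'n) set \<Rightarrow> real \<Rightarrow> real^'n \<Rightarrow> real" where
  "rayleigh E p f =
     ((\<Sum>(i,j)\<in>E. \<bar>f$i - f$j\<bar> powr p) / 2) / (\<Sum>i\<in>UNIV. \<bar>f$i\<bar> powr p)"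

definition p_sphere :: "real \<Rightarrow> (real^'n::finite) set" where
  "p_sphere p = {f. (\<Sum>i\<in>UNIV. \<bar>f$i\<bar> powr p) = 1}"

text \<open>Krasnoselskii genus: least k such that there is an odd continuous map
B \<rightarrow> R^k - {0}; R^k is represented as the functions nat \<Rightarrow> real vanishing outside {..<k}
(product topology). The genus of the empty set is 0.\<close>
definition kgenus :: "(real^'n::finite) set \<Rightarrow> nat" where
  "kgenus B = (LEAST k. \<exists>g :: real^'n \<Rightarrow> (nat \<Rightarrow> real).
       continuous_on B g \<and> (\<forall>x\<in>B. g (-x) = (\<lambda>i. - g x i)) \<and>
       (\<forall>x\<in>B. g x \<noteq> (\<lambda>i. 0) \<and> (\<forall>i\<ge>k. g x i = 0)))"

definition genus_family :: "nat \<Rightarrow> real \<Rightarrow> (real^'n::finite) set set" where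
  "genus_family k p = {B. closed B \<and> B \<subseteq> p_sphere p \<and> (\<forall>x\<in>B. -x \<in> B) \<and> kgenus B \<ge> k}"

definition var_eigenvalue :: "('n::finite \<times> 'n) set \<Rightarrow> nat \<Rightarrow> real \<Rightarrow> real" where
  "var_eigenvalue E k p = (INF B\<in>(genus_family k p :: (real^'n) set set). SUP f\<in>B. rayleigh E p f)"

definition cutoff_eig :: "('n::finite \<times> 'n) set \<Rightarrow> nat \<Rightarrow> real" where
  "cutoff_eig E k = Lim at_top (\<lambda>p::real. 2 powr (-p) * var_eigenvalue E k p)"

definition star_plus_isolated :: "('n::finite \<times> 'n) set \<Rightarrow> nat \<Rightarrow> bool" where
  "star_plus_isolated E m \<longleftrightarrow> m \<ge> 1 \<and> (\<exists>c S. c \<notin> S \<and> card S = m \<and>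
      E = {(c,s) | s. s \<in> S} \<union> {(s,c) | s. s \<in> S})"

end

theory Submission
  imports Defs "HOL-Homology.Homology" "HOL-Real_Asymp.Real_Asymp"
begin

text \<open>
Substituting \<open>y i = sgn (f i) * |f i| powr (p/2)\<close> turns the scaled Rayleigh quotient into a functional on the
Euclidean sphere in which an edge contributes at least \<open>- y i * y j\<close> and which decreases in \<open>p\<close>. Hence
\<open>2 powr (-p)\<close> times each variational eigenvalue decreases in \<open>p\<close>, and the cut-off eigenvalues exist.

If the graph contains two disjoint edges or a triangle, sum \<open>y\<close> over the two edges, respectively over the
triangle. This is an odd map to a space of dimension \<open>n - 2\<close>, so it vanishes somewhere on every set of
genus \<open>n - 1\<close>, and there the edge terms add up to \<open>1/2\<close>; thus the \<open>(n-1)\<close>-st cut-off eigenvalue is at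
least \<open>1/2\<close>. A graph without two disjoint edges and without a triangle is a star or has no edge.

For a star, the functions that vanish at the centre form a sphere of genus \<open>n - 1\<close> with scaled quotient at
most \<open>2 powr (-p)\<close>. A set of genus \<open>n\<close> is the whole sphere, and weighted convexity gives the exact maximum
of the quotient there, whose scaled limit is \<open>sqrt m / 2\<close>.

The genus of a sphere is the Borsuk-Ulam theorem, that is, odd self-maps of spheres have odd degree. By
induction on the dimension: an odd polynomial approximation of the map sends the equator into the
complement of a line, so the map can be deformed through odd maps until it preserves the equator, where
the parity of the degree does not change.
\<close>

section \<open>The Borsuk-Ulam theorem\<close>

definition coord_proj :: "'n set \<Rightarrow> real^'n::finite \<Rightarrow> real^'n" where
  "coord_proj K x = (\<chi> i. if i \<in> K then x $ i else 0)"

lemma coord_proj_nth [simp]: "coord_proj K x $ i = (if i \<in> K then x $ i else 0)"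
  by (simp add: coord_proj_def)

lemma bounded_linear_coord_proj: "bounded_linear (coord_proj K :: real^'n::finite \<Rightarrow> real^'n)"
  by (intro linear_conv_bounded_linear[THEN iffD1] linearI) (auto simp: vec_eq_iff)

text \<open>The cone over the image of the equator is the image of a hyperplane under the map \<open>\<Phi>\<close> below, which is
differentiable off a null set; the coordinates outside \<open>K\<close> are carried along unchanged to keep the
dimensions equal.\<close>
lemma polynomial_misses_line:
  fixes g :: "real^'n::finite \<Rightarrow> real^'n"
  assumes poly: "polynomial_function g" and odd: "\<And>x. g (-x) = - g x" and "k \<in> K"
  obtains a where "a $ k \<noteq> 0"
    and "\<And>u c. \<lbrakk>norm u = 1; u $ k = 0; \<forall>i. i \<notin> K \<longrightarrow> u $ i = 0; \<exists>i\<in>K. g u $ i \<noteq> 0\<rbrakk>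
           \<Longrightarrow> \<not> (\<forall>i\<in>K. g u $ i = c * a $ i)"
proof -
  let ?P = "coord_proj (K - {k}) :: real^'n \<Rightarrow> real^'n"
  define \<Phi> where "\<Phi> = (\<lambda>x. norm (?P x) *\<^sub>R coord_proj K (g (inverse (norm (?P x)) *\<^sub>R ?P x)) + coord_proj (-K) x)"
  define H where "H = {x::real^'n. axis k 1 \<bullet> x = 0}"
  define D where "D = H \<inter> {x. ?P x \<noteq> 0}"
  have negH: "negligible H"
    unfolding H_def by (rule negligible_hyperplane) (simp add: axis_eq_0_iff)
  have negD: "negligible D"
    using negH by (rule negligible_subset) (auto simp: D_def)
  have diffP: "coord_proj L differentiable (at x)" for L and x :: "real^'n"
    by (rule bounded_linear_imp_differentiable[OF bounded_linear_coord_proj])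
  have "\<Phi> differentiable (at x)" if "?P x \<noteq> 0" for x
  proof -
    have n: "(\<lambda>x. norm (?P x)) differentiable (at x)"
      using differentiable_chain_at[OF diffP[of "K - {k}" x], of norm] that by (simp add: o_def)
    have q: "(\<lambda>x. inverse (norm (?P x)) *\<^sub>R ?P x) differentiable (at x)"
      by (intro differentiable_scaleR differentiable_inverse n diffP) (use that in auto)
    have "(\<lambda>x. g (inverse (norm (?P x)) *\<^sub>R ?P x)) differentiable (at x)"
      using differentiable_chain_at[OF q differentiable_at_polynomial_function[OF poly]]
      by (simp add: o_def)
    from differentiable_chain_at[OF this diffP[of K]]
    show ?thesis
      unfolding \<Phi>_def by (intro differentiable_add differentiable_scaleR n diffP) (simp add: o_def)
  qed
  then have "\<Phi> differentiable_on D"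
    by (auto simp: D_def intro: differentiable_at_imp_differentiable_on)
  then have "negligible (\<Phi> ` D)"
    by (intro negligible_differentiable_image_negligible negD) auto
  \<comment> \<open>Including \<open>H\<close> in the null set forces the chosen point
    \<open>b\<close> to have a nonzero coordinate \<open>k\<close>.\<close>
  then have "negligible (\<Phi> ` D \<union> H)"
    using negH by (rule negligible_Un)
  then obtain b where "b \<notin> \<Phi> ` D \<union> H"
    using non_negligible_UNIV UNIV_eq_I by metis
  then have b: "b \<notin> \<Phi> ` D" "b \<notin> H"
    by simp_all
  have bad: False if u: "norm u = 1" "u $ k = 0" "\<forall>i. i \<notin> K \<longrightarrow> u $ i = 0"
    and eq: "\<forall>i\<in>K. g u $ i = c * b $ i" and c: "c > 0" for u c
  proof -
    \<comment> \<open>The radius \<open>inverse c\<close> enters \<open>\<Phi>\<close> as a factor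
      and turns \<open>g u\<close> into \<open>b\<close> on \<open>K\<close>; the coordinates
      outside \<open>K\<close> are copied from \<open>b\<close>.\<close>
    let ?x = "inverse c *\<^sub>R u + coord_proj (-K) b"
    have Px: "?P ?x = inverse c *\<^sub>R u"
      using u \<open>k \<in> K\<close> by (auto simp: vec_eq_iff)
    have nPx: "norm (?P ?x) = inverse c"
      unfolding Px using u c by simp
    have "?x \<in> D"
      using u c \<open>k \<in> K\<close> unfolding D_def H_def Int_iff mem_Collect_eq Px by (auto simp: inner_axis' )
    moreover have "\<Phi> ?x = b"
      unfolding \<Phi>_def nPx Px using eq c u by (auto simp: vec_eq_iff)
    ultimately show False
      using b(1) by (metis (no_types, lifting) image_eqI)
  qed
  show thesis
  proof
    show "b $ k \<noteq> 0"
      using b(2) by (simp add: inner_axis' H_def)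
    fix u c
    assume u: "norm u = 1" "u $ k = 0" "\<forall>i. i \<notin> K \<longrightarrow> u $ i = 0" and nz: "\<exists>i\<in>K. g u $ i \<noteq> 0"
    show "\<not> (\<forall>i\<in>K. g u $ i = c * b $ i)"
    proof
      assume eq: "\<forall>i\<in>K. g u $ i = c * b $ i"
      \<comment> \<open>A zero factor is excluded because \<open>g u\<close> does not vanish on
        \<open>K\<close>; a negative one becomes positive on passing to \<open>-u\<close>, since
        \<open>g\<close> is odd.\<close>
      consider "c = 0" | "c > 0" | "-c > 0" by linarith
      then show False
      proof cases
        case 1
        with eq nz show False by auto
      next
        case 2
        with bad[OF u eq] show False by simp
      next
        case 3
        have "\<forall>i\<in>K. g (-u) $ i = (-c) * b $ i" using eq by (simp add: odd)
        with bad[of "-u" "-c"] u 3 show False by simp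
      qed
    qed
  qed
qed

section \<open>Spheres as sets of sequences, radial projection and Brouwer degree\<close>

definition usphere :: "nat \<Rightarrow> (nat \<Rightarrow> real) set" where
  "usphere n = {x. (\<Sum>i\<le>n. (x i)\<^sup>2) = 1 \<and> (\<forall>i>n. x i = 0)}"

lemma nsphere_eq_usphere: "nsphere n = top_of_set (usphere n)"
  by (simp add: nsphere usphere_def euclidean_product_topology)

lemma topspace_nsphere [simp]: "topspace (nsphere n) = usphere n"
  by (simp add: nsphere_eq_usphere)

lemma uminus_usphere [simp]: "(\<lambda>i. - x i) \<in> usphere n \<longleftrightarrow> x \<in> usphere n"
  by (simp add: usphere_def)

lemma continuous_map_nsphere_iff:
  "continuous_map (nsphere m) (nsphere n) f \<longleftrightarrow> continuous_on (usphere m) f \<and> f ` usphere m \<subseteq> usphere n"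
  by (auto simp: nsphere_eq_usphere)

definition normalize_to :: "nat \<Rightarrow> (nat \<Rightarrow> real) \<Rightarrow> nat \<Rightarrow> real" where
  "normalize_to n y = (\<lambda>i. if i \<le> n then y i / sqrt (\<Sum>j\<le>n. (y j)\<^sup>2) else 0)"

lemma normalize_to_in_usphere:
  assumes "\<exists>i\<le>n. y i \<noteq> 0"
  shows "normalize_to n y \<in> usphere n"
proof -
  have "(\<Sum>j\<le>n. (y j)\<^sup>2) > 0"
    using assms by (auto intro!: sum_pos2)
  then show ?thesis
    by (simp add: usphere_def normalize_to_def power_divide flip: sum_divide_distrib)
qed

lemma normalize_to_id: "y \<in> usphere n \<Longrightarrow> normalize_to n y = y"
  by (auto simp: usphere_def normalize_to_def fun_eq_iff)

lemma normalize_to_uminus: "normalize_to n (\<lambda>i. - y i) = (\<lambda>i. - normalize_to n y i)"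
  by (auto simp: normalize_to_def fun_eq_iff)

lemma continuous_on_normalize_to:
  assumes "\<And>i. i \<le> n \<Longrightarrow> continuous_on S (\<lambda>x. f x i)" and "\<And>x. x \<in> S \<Longrightarrow> \<exists>i\<le>n. f x i \<noteq> 0"
  shows "continuous_on S (\<lambda>x. normalize_to n (f x))"
proof (rule continuous_on_coordinatewise_then_product)
  fix i
  have "(\<Sum>j\<le>n. (f x j)\<^sup>2) > 0" if "x \<in> S" for x
    using assms(2)[OF that] by (auto intro!: sum_pos2)
  then have "sqrt (\<Sum>j\<le>n. (f x j)\<^sup>2) \<noteq> 0" if "x \<in> S" for x
    using that by fastforce
  then show "continuous_on S (\<lambda>x. normalize_to n (f x) i)"
    unfolding normalize_to_def by (cases "i \<le> n") (auto intro!: continuous_intros assms)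
qed

text \<open>The segments from \<open>F x\<close> to \<open>G x\<close> avoid zero, so their radial
  projection is a homotopy, and homotopic maps have equal degree.\<close>

lemma degree_normalize_cong:
  fixes F G :: "(nat \<Rightarrow> real) \<Rightarrow> nat \<Rightarrow> real"
  assumes F: "\<And>i. i \<le> n \<Longrightarrow> continuous_on (usphere n) (\<lambda>x. F x i)"
    and G: "\<And>i. i \<le> n \<Longrightarrow> continuous_on (usphere n) (\<lambda>x. G x i)"
    and nz: "\<And>x t. \<lbrakk>x \<in> usphere n; 0 \<le> t; t \<le> 1\<rbrakk> \<Longrightarrow> \<exists>i\<le>n. (1 - t) * F x i + t * G x i \<noteq> 0"
  shows "Brouwer_degree2 n (\<lambda>x. normalize_to n (F x)) = Brouwer_degree2 n (\<lambda>x. normalize_to n (G x))"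
proof (rule Brouwer_degree2_homotopic)
  let ?h = "\<lambda>(t::real, x). normalize_to n (\<lambda>i. (1 - t) * F x i + t * G x i)"
  have *: "continuous_on ({0..1} \<times> usphere n) (\<lambda>z. F (snd z) i)"
    "continuous_on ({0..1} \<times> usphere n) (\<lambda>z. G (snd z) i)" if "i \<le> n" for i
    by (rule continuous_on_compose2[OF F[OF that] continuous_on_snd[OF continuous_on_id]],
        force, rule continuous_on_compose2[OF G[OF that] continuous_on_snd[OF continuous_on_id]], force)
  have "continuous_on ({0..1} \<times> usphere n) ?h"
    unfolding split_beta
    by (rule continuous_on_normalize_to) (use nz in \<open>auto intro!: continuous_intros *\<close>)
  moreover have "?h ` ({0..1} \<times> usphere n) \<subseteq> usphere n"
    using nz by (auto intro!: normalize_to_in_usphere)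
  ultimately show "homotopic_with (\<lambda>x. True) (nsphere n) (nsphere n)
     (\<lambda>x. normalize_to n (F x)) (\<lambda>x. normalize_to n (G x))"
    unfolding homotopic_with_def nsphere_eq_usphere
    by (intro exI[of _ ?h]) (auto simp: prod_topology_subtopology_eu)
qed

text \<open>General position for the equator: \<open>g\<close> is an odd polynomial approximation of \<open>f\<close>, so its values on the
equator are confined to a null set of directions. The vertex type only serves as a Euclidean space of
sufficiently large dimension in which Lebesgue measure and polynomials are available.\<close>
lemma generic_odd_approximation:
  fixes f :: "(nat \<Rightarrow> real) \<Rightarrow> nat \<Rightarrow> real"
  assumes dim: "n < CARD('n::finite)"
    and contf: "continuous_on (usphere n) f" and fim: "f ` usphere n \<subseteq> usphere n"
    and oddf: "\<And>x. x \<in> usphere n \<Longrightarrow> f (\<lambda>i. - x i) = (\<lambda>i. - f x i)"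
  obtains g a where "\<And>i. continuous_on (usphere n) (\<lambda>x. g x i)"
    and "\<And>x. g (\<lambda>i. - x i) = (\<lambda>i. - g x i)"
    and "\<And>x. x \<in> usphere n \<Longrightarrow> (\<Sum>i\<le>n. (f x i - g x i)\<^sup>2) < 1"
    and "a n \<noteq> 0"
    and "\<And>x c. \<lbrakk>x \<in> usphere n; x n = 0; \<exists>i\<le>n. g x i \<noteq> 0\<rbrakk> \<Longrightarrow> \<not> (\<forall>i\<le>n. g x i = c * a i)"
proof -
  \<comment> \<open>\<open>e\<close> and \<open>d\<close> match the indices up to \<open>n\<close>
    with some of the vertices; \<open>v\<close> and \<open>w\<close> thereby identify the sphere
    with the coordinate sphere \<open>T\<close> in \<open>real^'n\<close>.\<close>
  obtain e where e: "bij_betw e (UNIV :: 'n set) {0..<CARD('n)}"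
    using ex_bij_betw_finite_nat[of "UNIV :: 'n set"] by auto
  define d where "d = inv_into UNIV e"
  have de [simp]: "d (e i) = i" for i
    using e by (simp add: d_def bij_betw_def inv_into_f_f)
  have ed [simp]: "e (d k) = k" if "k \<le> n" for k
    unfolding d_def by (rule bij_betw_inv_into_right[OF e]) (use that dim in auto)
  define v where "v x = (\<chi> i. if e i \<le> n then x (e i) else 0)" for x :: "nat \<Rightarrow> real"
  define w where "w y = (\<lambda>k. if k \<le> n then y $ d k else 0)" for y :: "real^'n"
  have wv: "w (v x) = x" if "x \<in> usphere n" for x
    using that by (auto simp: w_def v_def usphere_def fun_eq_iff)
  have reindex: "(\<Sum>k\<le>n. h k) = (\<Sum>i | e i \<le> n. h (e i))" for h :: "nat \<Rightarrow> real"
    by (rule sum.reindex_bij_witness[of _ e d]) auto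
  have norm2: "(norm y)\<^sup>2 = (\<Sum>i\<in>UNIV. (y $ i)\<^sup>2)" for y :: "real^'n"
    unfolding power2_norm_eq_inner inner_vec_def by (simp add: power2_eq_square)
  have normv: "(norm (v x))\<^sup>2 = (\<Sum>k\<le>n. (x k)\<^sup>2)" for x
    unfolding norm2 reindex by (intro sum.mono_neutral_cong_right) (auto simp: v_def)
  define T where "T = {y::real^'n. norm y = 1 \<and> (\<forall>i. \<not> e i \<le> n \<longrightarrow> y $ i = 0)}"
  have vT: "v x \<in> T" if "x \<in> usphere n" for x
  proof -
    have "(norm (v x))\<^sup>2 = 1" using that by (simp only: normv) (simp add: usphere_def)
    then have "norm (v x) = 1" by (simp add: power2_eq_1_iff) (metis norm_ge_zero not_one_le_zero neg_0_le_iff_le) 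
    then show ?thesis by (simp add: T_def v_def)
  qed
  have wT: "w y \<in> usphere n" and vw: "v (w y) = y" if "y \<in> T" for y
  proof -
    show vw: "v (w y) = y"
      using that by (auto simp: T_def v_def w_def vec_eq_iff)
    have "(\<Sum>k\<le>n. (w y k)\<^sup>2) = 1"
      unfolding normv[symmetric] vw using that by (simp add: T_def)
    then show "w y \<in> usphere n"
      by (simp add: usphere_def w_def)
  qed
  have "closed (sphere 0 1 \<inter> (\<Inter>i\<in>{i. \<not> e i \<le> n}. {y::real^'n. y $ i = 0}))"
    by (intro closed_Int closed_INT ballI closed_Collect_eq closed_sphere continuous_intros)
  also have "sphere 0 1 \<inter> (\<Inter>i\<in>{i. \<not> e i \<le> n}. {y::real^'n. y $ i = 0}) = T"
    by (auto simp: T_def)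
  finally have "closed T" .
  moreover have "bounded T"
    by (rule bounded_subset[OF bounded_sphere[of 0 1]]) (auto simp: T_def)
  ultimately have "compact T"
    by (simp add: compact_eq_bounded_closed)
  have cw: "continuous_on S w" for S
    unfolding w_def
  proof (rule continuous_on_coordinatewise_then_product)
    show "continuous_on S (\<lambda>y. if k \<le> n then y $ d k else 0)" for k
      by (cases "k \<le> n") (auto intro!: continuous_intros)
  qed
  have cv: "continuous_on S v" for S
    unfolding v_def
  proof (rule continuous_on_vec_lambda)
    show "continuous_on S (\<lambda>x. if e i \<le> n then x (e i) else 0)" for i
      by (cases "e i \<le> n") (auto intro: continuous_on_subset[OF continuous_on_product_coordinates])
  qed
  define F where "F y = v (f (w y))" for y
  have "continuous_on T F"
    unfolding F_def
    by (rule continuous_on_compose2[OF cv[of UNIV] continuous_on_compose2[OF contf cw]])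
       (use wT in auto)
  from Stone_Weierstrass_polynomial_function[OF \<open>compact T\<close> this, of 1]
  obtain g0 where g0: "polynomial_function g0" "\<And>y. y \<in> T \<Longrightarrow> norm (F y - g0 y) < 1"
    by auto
  \<comment> \<open>The odd part of the approximation. As \<open>F\<close> is odd, averaging the
    errors at \<open>y\<close> and \<open>-y\<close> keeps the error below \<open>1\<close>.\<close>
  define g1 where "g1 y = (1/2) *\<^sub>R (g0 y - g0 (-y))" for y
  have "polynomial_function (g0 \<circ> uminus)"
    by (intro polynomial_function_compose g0 polynomial_function_minus polynomial_function_id)
  then have poly: "polynomial_function g1"
    unfolding g1_def o_def
    by (intro polynomial_function_cmul polynomial_function_diff g0)
  have odd1: "g1 (-y) = - g1 y" for y
    by (simp add: g1_def algebra_simps)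
  have Tm: "-y \<in> T" if "y \<in> T" for y
    using that by (simp add: T_def)
  have close: "norm (F y - g1 y) < 1" if "y \<in> T" for y
  proof -
    have "w (-y) = (\<lambda>i. - w y i)"
      by (auto simp: w_def)
    then have "F (-y) = - F y"
      using oddf[OF wT[OF that]] by (auto simp: F_def v_def vec_eq_iff)
    then have "F y - g1 y = (1/2) *\<^sub>R ((F y - g0 y) - (F (-y) - g0 (-y)))"
      by (simp add: g1_def vec_eq_iff field_simps)
    then show ?thesis
      using g0(2)[OF that] g0(2)[OF Tm[OF that]] norm_triangle_ineq4[of "F y - g0 y" "F (-y) - g0 (-y)"]
      by simp
  qed
  \<comment> \<open>The coordinate \<open>d n\<close> is the one whose vanishing cuts out the
    equator.\<close>
  obtain b where b: "b $ d n \<noteq> 0"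
    "\<And>u c. \<lbrakk>norm u = 1; u $ d n = 0; \<forall>i. i \<notin> {i. e i \<le> n} \<longrightarrow> u $ i = 0; \<exists>i\<in>{i. e i \<le> n}. g1 u $ i \<noteq> 0\<rbrakk>
           \<Longrightarrow> \<not> (\<forall>i\<in>{i. e i \<le> n}. g1 u $ i = c * b $ i)"
    by (rule polynomial_misses_line[OF poly odd1, of "d n" "{i. e i \<le> n}"]) auto
  show thesis
  proof
    show "continuous_on (usphere n) (\<lambda>x. w (g1 (v x)) i)" for i
      by (rule continuous_on_product_then_coordinatewise,
          rule continuous_on_compose2[OF cw[of UNIV]
            continuous_on_compose2[OF continuous_on_polymonial_function[OF poly, of UNIV] cv]]) auto
    show "w (g1 (v (\<lambda>i. - x i))) = (\<lambda>i. - w (g1 (v x)) i)" for x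
    proof -
      have "v (\<lambda>i. - x i) = - v x" by (auto simp: v_def vec_eq_iff)
      then show ?thesis by (auto simp: odd1 w_def)
    qed
    show "(\<Sum>i\<le>n. (f x i - w (g1 (v x)) i)\<^sup>2) < 1" if x: "x \<in> usphere n" for x
    proof -
      have "(\<Sum>i\<le>n. (f x i - w (g1 (v x)) i)\<^sup>2) = (\<Sum>i | e i \<le> n. ((F (v x) - g1 (v x)) $ i)\<^sup>2)"
        unfolding reindex by (rule sum.cong) (auto simp: F_def wv[OF x] v_def[of "f x"] w_def[of "g1 (v x)"])
      also have "\<dots> \<le> (norm (F (v x) - g1 (v x)))\<^sup>2"
        unfolding norm2 by (rule sum_mono2) auto
      also have "\<dots> < 1"
        using close[OF vT[OF x]] by (simp add: power_less_one_iff abs_square_less_1)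
      finally show ?thesis .
    qed
    show "w b n \<noteq> 0"
      using b(1) by (simp add: w_def)
    show "\<not> (\<forall>i\<le>n. w (g1 (v x)) i = c * w b i)"
      if x: "x \<in> usphere n" "x n = 0" "\<exists>i\<le>n. w (g1 (v x)) i \<noteq> 0" for x c
    proof
      assume eq: "\<forall>i\<le>n. w (g1 (v x)) i = c * w b i"
      have "v x \<in> T" by (rule vT[OF x(1)])
      then have "norm (v x) = 1" "\<forall>i. i \<notin> {i. e i \<le> n} \<longrightarrow> v x $ i = 0"
        by (auto simp: T_def)
      moreover have "v x $ d n = 0" using x(2) by (simp add: v_def)
      moreover obtain j where "j \<le> n" "w (g1 (v x)) j \<noteq> 0"
        using x(3) by blast
      then have "\<exists>i\<in>{i. e i \<le> n}. g1 (v x) $ i \<noteq> 0"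
        by (intro bexI[of _ "d j"]) (auto simp: w_def)
      moreover have "g1 (v x) $ i = c * b $ i" if "e i \<le> n" for i
        using eq[rule_format, OF that] that by (simp add: w_def)
      ultimately show False
        using b(2)[of "v x" c] by blast
    qed
  qed
qed

text \<open>The induction step replaces \<open>f\<close> by \<open>g\<close>, \<open>H\<close> and
  \<open>K\<close> in turn. Each replacement runs along segments avoiding zero and so keeps the
  degree; the normalized \<open>K\<close> maps the equator to itself, where the induction hypothesis
  applies.\<close>

lemma odd_map_odd_degree:
  assumes "n < CARD('n::finite)"
    and "continuous_on (usphere n) f" and "f ` usphere n \<subseteq> usphere n"
    and "\<And>x. x \<in> usphere n \<Longrightarrow> f (\<lambda>i. - x i) = (\<lambda>i. - f x i)"
  shows "odd (Brouwer_degree2 n f)"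
  using assms
proof (induction n arbitrary: f)
  case 0
  have mem: "x \<in> usphere 0 \<longleftrightarrow> x = (\<lambda>i. if i = 0 then 1 else 0) \<or> x = (\<lambda>i. if i = 0 then -1 else 0)" for x
    by (auto simp: usphere_def fun_eq_iff power2_eq_1_iff)
  let ?p = "\<lambda>i::nat. if i = 0 then 1 else 0::real" and ?m = "\<lambda>i::nat. if i = 0 then -1 else 0::real"
  have pm: "(\<lambda>i. - ?p i) = ?m" "(\<lambda>i. - ?m i) = ?p" by auto
  have fm: "f ?m = (\<lambda>i. - f ?p i)"
    using "0.prems"(4)[of ?p] by (simp only: pm mem) simp
  have "f ?p = ?p \<or> f ?p = ?m"
    using "0.prems"(3) mem by blast
  \<comment> \<open>The sphere is a pair of antipodal points, so an odd self-map is an involution,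
    hence a homeomorphism of degree \<open>1\<close> or \<open>-1\<close>.\<close>
  then have ff: "f (f x) = x" if "x \<in> usphere 0" for x
    using that fm unfolding mem by (auto simp: pm)
  have "homeomorphic_maps (nsphere 0) (nsphere 0) f f"
    using "0.prems" ff by (auto simp: homeomorphic_maps_def continuous_map_nsphere_iff)
  then have "\<bar>Brouwer_degree2 0 f\<bar> = 1"
    using Brouwer_degree2_homeomorphic_maps by blast
  then show ?case
    by (metis dvd_abs_iff odd_one)
next
  case (Suc n)
  let ?n = "Suc n"
  show ?case
  proof (rule generic_odd_approximation[OF Suc.prems])
    fix g a
    assume cg: "\<And>i. continuous_on (usphere ?n) (\<lambda>x. g x i)"
      and og: "\<And>x. g (\<lambda>i. - x i) = (\<lambda>i. - g x i)"
      and close: "\<And>x. x \<in> usphere ?n \<Longrightarrow> (\<Sum>i\<le>?n. (f x i - g x i)\<^sup>2) < 1"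
      and a: "a ?n \<noteq> 0"
      and miss: "\<And>x c. \<lbrakk>x \<in> usphere ?n; x ?n = 0; \<exists>i\<le>?n. g x i \<noteq> 0\<rbrakk> \<Longrightarrow> \<not> (\<forall>i\<le>?n. g x i = c * a i)"
    have cf: "continuous_on (usphere ?n) (\<lambda>x. f x i)" for i
      by (rule continuous_on_product_then_coordinatewise[OF Suc.prems(2)])
    \<comment> \<open>A zero on the segment would give \<open>f x = t * (f x - g x)\<close>, of norm
      less than \<open>1\<close>, although \<open>f x\<close> is a unit vector.\<close>
    have seg: "\<exists>i\<le>?n. (1 - t) * f x i + t * g x i \<noteq> 0" if x: "x \<in> usphere ?n" and t: "0 \<le> t" "t \<le> 1" for x t
    proof (rule ccontr)
      assume "\<not> ?thesis"
      then have "f x i = t * (f x i - g x i)" if "i \<le> ?n" for i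
        using that by (simp add: algebra_simps)
      then have "(\<Sum>i\<le>?n. (f x i)\<^sup>2) = (\<Sum>i\<le>?n. t\<^sup>2 * (f x i - g x i)\<^sup>2)"
        by (intro sum.cong refl) (metis atMost_iff power_mult_distrib)
      also have "\<dots> = t\<^sup>2 * (\<Sum>i\<le>?n. (f x i - g x i)\<^sup>2)"
        by (simp only: sum_distrib_left)
      also have "\<dots> \<le> 1 * (\<Sum>i\<le>?n. (f x i - g x i)\<^sup>2)"
        by (intro mult_right_mono) (use t in \<open>auto simp: power_le_one sum_nonneg\<close>)
      also have "\<dots> < 1" using close[OF x] by simp
      finally have "(\<Sum>i\<le>?n. (f x i)\<^sup>2) < 1" .
      moreover have "f x \<in> usphere ?n" using Suc.prems(3) x by blast
      ultimately show False by (simp only: usphere_def mem_Collect_eq)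
    qed
    have gnz: "\<exists>i\<le>?n. g x i \<noteq> 0" if "x \<in> usphere ?n" for x
      using seg[OF that, of 1] by simp
    \<comment> \<open>A shear moves the missed direction \<open>a\<close> to the pole.\<close>
    define H where "H x i = (if i = ?n then g x i else g x i - g x ?n * (a i / a ?n))" for x i
    have Hn: "H x ?n = g x ?n" for x by (simp add: H_def)
    have cH: "continuous_on (usphere ?n) (\<lambda>x. H x i)" for i
      by (cases "i = ?n") (auto simp: H_def divide_inverse intro!: continuous_on_diff continuous_on_mult continuous_on_const cg)
    have oH: "H (\<lambda>i. - x i) = (\<lambda>i. - H x i)" for x
      by (auto simp: H_def og fun_eq_iff)
    \<comment> \<open>Either \<open>g x ?n\<close> is zero and the shear fixes \<open>g x\<close>,
      or the last coordinate is nonzero and constant along the segment.\<close>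
    have segH: "\<exists>i\<le>?n. (1 - t) * g x i + t * H x i \<noteq> 0" if x: "x \<in> usphere ?n" for x t
    proof (cases "g x ?n = 0")
      case True
      then have "(1 - t) * g x i + t * H x i = g x i" for i
        by (simp add: H_def algebra_simps)
      then show ?thesis using gnz[OF x] by simp
    next
      case False
      then show ?thesis
        by (intro exI[of _ ?n]) (simp add: Hn algebra_simps)
    qed
    have Hnz: "\<exists>i\<le>?n. H x i \<noteq> 0" if "x \<in> usphere ?n" for x
      using segH[OF that, of 1] by simp
    define r where "r x = (\<Sum>i\<le>n. (H x i)\<^sup>2)" for x
    have r0: "r x \<ge> 0" for x by (simp add: r_def sum_nonneg)
    \<comment> \<open>On the equator a zero of \<open>r\<close> would make \<open>g x\<close> a
      multiple of \<open>a\<close>, the direction that \<open>g\<close> misses there.\<close>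
    have requ: "r x \<noteq> 0" if x: "x \<in> usphere ?n" "x ?n = 0" for x
    proof
      assume "r x = 0"
      then have "H x i = 0" if "i \<le> n" for i
        using that by (simp add: r_def sum_nonneg_eq_0_iff)
      then have "g x i = (g x ?n / a ?n) * a i" if "i \<le> ?n" for i
        using that a by (cases "i = ?n") (auto simp: H_def le_Suc_eq)
      with miss[OF x gnz[OF x(1)]] show False by blast
    qed
    \<comment> \<open>The factor \<open>s\<close> vanishes on the equator and equals \<open>1\<close> wherever \<open>H x\<close> points to a pole.\<close>
    define s where "s x = \<bar>x ?n\<bar> / (r x + \<bar>x ?n\<bar>)" for x :: "nat \<Rightarrow> real"
    have den: "r x + \<bar>x ?n\<bar> \<noteq> 0" if "x \<in> usphere ?n" for x
      using requ[OF that] r0[of x] by (cases "x ?n = 0") auto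
    define K where "K x i = (if i = ?n then H x i * s x else H x i)" for x i
    have cr: "continuous_on (usphere ?n) r"
      unfolding r_def by (intro continuous_on_sum continuous_on_power cH)
    have cx: "continuous_on (usphere ?n) (\<lambda>x. x ?n)"
      by (rule continuous_on_subset[OF continuous_on_product_coordinates]) simp
    have cs: "continuous_on (usphere ?n) s"
      unfolding s_def by (intro continuous_on_divide continuous_on_add continuous_on_rabs cr cx) (use den in auto)
    have cK: "continuous_on (usphere ?n) (\<lambda>x. K x i)" for i
      by (cases "i = ?n") (auto simp: K_def intro!: continuous_on_mult cH cs)
    have rm: "r (\<lambda>i. - x i) = r x" for x
      by (simp add: r_def oH)
    have oK: "K (\<lambda>i. - x i) = (\<lambda>i. - K x i)" for x
      by (auto simp: K_def oH s_def rm fun_eq_iff)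
    \<comment> \<open>Where \<open>r\<close> vanishes, \<open>s\<close> is \<open>1\<close> and
      \<open>K\<close> agrees with \<open>H\<close>; elsewhere a nonzero coordinate below the last
      one is left unchanged.\<close>
    have segK: "\<exists>i\<le>?n. (1 - t) * H x i + t * K x i \<noteq> 0" if x: "x \<in> usphere ?n" for x t
    proof (cases "r x = 0")
      case True
      then have "s x = 1" using den[OF x] by (simp add: s_def)
      then have "(1 - t) * H x i + t * K x i = H x i" for i
        by (simp add: K_def algebra_simps)
      then show ?thesis using Hnz[OF x] by simp
    next
      case False
      then obtain i where "i \<le> n" "H x i \<noteq> 0"
        by (auto simp: r_def sum_nonneg_eq_0_iff)
      then show ?thesis
        by (intro exI[of _ i]) (simp add: K_def algebra_simps)
    qed
    have Knz: "\<exists>i\<le>?n. K x i \<noteq> 0" if "x \<in> usphere ?n" for x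
      using segK[OF that, of 1] by simp
    define f' where "f' x = normalize_to ?n (K x)" for x
    have "Brouwer_degree2 ?n f = Brouwer_degree2 ?n (\<lambda>x. normalize_to ?n (f x))"
      using Suc.prems(3) by (intro Brouwer_degree2_eq) (auto simp: normalize_to_id image_subset_iff)
    also have "\<dots> = Brouwer_degree2 ?n (\<lambda>x. normalize_to ?n (g x))"
      by (rule degree_normalize_cong) (use cf cg seg in auto)
    also have "\<dots> = Brouwer_degree2 ?n (\<lambda>x. normalize_to ?n (H x))"
      by (rule degree_normalize_cong) (use cH cg segH in auto)
    also have "\<dots> = Brouwer_degree2 ?n f'"
      unfolding f'_def by (rule degree_normalize_cong) (use cH cK segK in auto)
    finally have deg: "Brouwer_degree2 ?n f = Brouwer_degree2 ?n f'" .
    have cf': "continuous_on (usphere ?n) f'"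
      unfolding f'_def by (rule continuous_on_normalize_to[OF cK Knz])
    have of': "f' (\<lambda>i. - x i) = (\<lambda>i. - f' x i)" for x
      by (simp add: f'_def oK normalize_to_uminus)
    have f'im: "f' ` usphere ?n \<subseteq> usphere ?n"
      using Knz by (auto simp: f'_def intro: normalize_to_in_usphere)
    have sub: "x \<in> usphere n \<longleftrightarrow> x \<in> usphere ?n \<and> x ?n = 0" for x
      by (auto simp: usphere_def) (metis Suc_lessI)
    \<comment> \<open>On the equator \<open>s\<close> kills the last coordinate of
      \<open>K\<close>.\<close>
    have f'im0: "f' ` usphere n \<subseteq> usphere n"
    proof
      fix y assume "y \<in> f' ` usphere n"
      then obtain x where x: "x \<in> usphere ?n" "x ?n = 0" "y = f' x"
        using sub by blast
      then have "f' x ?n = 0"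
        by (simp add: f'_def normalize_to_def K_def s_def)
      then show "y \<in> usphere n"
        unfolding sub using x f'im by blast
    qed
    have "even (Brouwer_degree2 ?n f' - Brouwer_degree2 (?n - Suc 0) f')"
      by (rule Borsuk_odd_mapping_degree_step)
         (use cf' f'im f'im0 of' in \<open>auto simp: continuous_map_nsphere_iff\<close>)
    moreover have "odd (Brouwer_degree2 n f')"
      by (rule Suc.IH) (use Suc.prems(1) cf' f'im0 of' sub in \<open>auto intro: continuous_on_subset\<close>)
    ultimately show "odd (Brouwer_degree2 ?n f)"
      by (simp add: deg)
  qed
qed

text \<open>Without a zero, the normalized map would be an odd self-map of the sphere and have odd
  degree; but its coordinate \<open>n\<close> vanishes, so it misses the pole and has degree
  \<open>0\<close>.\<close>

lemma Borsuk_Ulam_usphere: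
  fixes f :: "(nat \<Rightarrow> real) \<Rightarrow> nat \<Rightarrow> real"
  assumes dim: "n < CARD('n::finite)" and cont: "continuous_on (usphere n) f"
    and odd: "\<And>x. x \<in> usphere n \<Longrightarrow> f (\<lambda>i. - x i) = (\<lambda>i. - f x i)"
    and low: "\<And>x i. \<lbrakk>x \<in> usphere n; i \<ge> n\<rbrakk> \<Longrightarrow> f x i = 0"
  shows "\<exists>x\<in>usphere n. f x = (\<lambda>i. 0)"
proof (rule ccontr)
  assume neg: "\<not> ?thesis"
  let ?f = "\<lambda>x. normalize_to n (f x)"
  have nz: "\<exists>i\<le>n. f x i \<noteq> 0" if x: "x \<in> usphere n" for x
  proof (rule ccontr)
    assume "\<not> ?thesis"
    then have "f x i = 0" for i
      using low[OF x, of i] by (cases "i \<le> n") auto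
    then show False
      using neg x by (auto simp: fun_eq_iff)
  qed
  have c: "continuous_on (usphere n) ?f"
    by (rule continuous_on_normalize_to[OF continuous_on_product_then_coordinatewise[OF cont] nz])
  have im: "?f ` usphere n \<subseteq> usphere n"
    using nz by (auto intro: normalize_to_in_usphere)
  have "odd (Brouwer_degree2 n ?f)"
    using odd by (intro odd_map_odd_degree[OF dim c im]) (simp add: normalize_to_uminus)
  moreover have "Brouwer_degree2 n ?f = 0"
  proof (rule Brouwer_degree2_nonsurjective)
    show "continuous_map (nsphere n) (nsphere n) ?f"
      using c im by (simp add: continuous_map_nsphere_iff)
    let ?e = "\<lambda>i. if i = n then 1 else 0::real"
    have "?e \<in> usphere n"
      by (simp add: usphere_def if_distrib[of "\<lambda>x. x ^ 2"] cong: if_cong)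
    moreover have "?e \<notin> ?f ` usphere n"
    proof
      assume "?e \<in> ?f ` usphere n"
      then obtain x where "x \<in> usphere n" "?e = ?f x" by auto
      from fun_cong[OF this(2), of n] have "?f x n = 1" by simp
      then show False using low[OF \<open>x \<in> usphere n\<close>, of n] by (simp add: normalize_to_def)
    qed
    ultimately show "?f ` topspace (nsphere n) \<noteq> topspace (nsphere n)"
      by auto
  qed
  ultimately show False by simp
qed

section \<open>Genus of coordinate spheres\<close>

definition odd_map_to :: "nat \<Rightarrow> (real^'n::finite) set \<Rightarrow> (real^'n \<Rightarrow> nat \<Rightarrow> real) \<Rightarrow> bool" where
  "odd_map_to k B g \<longleftrightarrow> continuous_on B g \<and> (\<forall>x\<in>B. g (-x) = (\<lambda>i. - g x i)) \<and>
     (\<forall>x\<in>B. g x \<noteq> (\<lambda>i. 0) \<and> (\<forall>i\<ge>k. g x i = 0))"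

lemma kgenus_eq_Least: "kgenus B = (LEAST k. \<exists>g. odd_map_to k B g)"
  by (simp add: kgenus_def odd_map_to_def)

lemma kgenus_le: "odd_map_to k B g \<Longrightarrow> kgenus B \<le> k"
  unfolding kgenus_eq_Least by (rule Least_le) blast

text \<open>Renumbering the coordinates in \<open>T\<close> from \<open>0\<close> turns a
  vector-valued map into a witness for the genus.\<close>

lemma odd_map_to_coords:
  fixes \<phi> :: "real^'n::finite \<Rightarrow> real^'n"
  assumes cont: "continuous_on B \<phi>" and odd: "\<And>x. x \<in> B \<Longrightarrow> \<phi> (-x) = - \<phi> x"
    and nz: "\<And>x. x \<in> B \<Longrightarrow> \<exists>i\<in>T. \<phi> x $ i \<noteq> 0"
  shows "\<exists>g. odd_map_to (card T) B g"
proof -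
  obtain e where e: "bij_betw e T {0..<card T}"
    using ex_bij_betw_finite_nat[of T] by auto
  define d where "d = inv_into T e"
  define g where "g x = (\<lambda>k. if k < card T then \<phi> x $ d k else 0)" for x
  have "continuous_on B g"
    unfolding g_def
  proof (rule continuous_on_coordinatewise_then_product)
    show "continuous_on B (\<lambda>x. if k < card T then \<phi> x $ d k else 0)" for k
      by (cases "k < card T") (auto intro!: continuous_intros cont)
  qed
  moreover have "g x \<noteq> (\<lambda>i. 0)" if x: "x \<in> B" for x
  proof -
    obtain i where i: "i \<in> T" "\<phi> x $ i \<noteq> 0" using nz[OF x] by blast
    then have "g x (e i) \<noteq> 0"
      using e by (auto simp: g_def d_def bij_betw_def inv_into_f_f)
    then show ?thesis by auto
  qed
  ultimately have "odd_map_to (card T) B g"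
    by (auto simp: odd_map_to_def g_def odd)
  then show ?thesis by blast
qed

lemma kgenus_le_card:
  fixes \<phi> :: "real^'n::finite \<Rightarrow> real^'n"
  assumes "continuous_on B \<phi>" and "\<And>x. x \<in> B \<Longrightarrow> \<phi> (-x) = - \<phi> x"
    and "\<And>x. x \<in> B \<Longrightarrow> \<exists>i\<in>T. \<phi> x $ i \<noteq> 0"
  shows "kgenus B \<le> card T"
  using odd_map_to_coords[OF assms] kgenus_le by blast

text \<open>The inclusion of \<open>B\<close> into \<open>real^'n\<close> is a witness, so the
  minimum in \<open>kgenus\<close> is attained.\<close>

lemma odd_map_to_kgenus:
  fixes B :: "(real^'n::finite) set"
  assumes "0 \<notin> B"
  shows "\<exists>g. odd_map_to (kgenus B) B g"
proof -
  have "\<exists>g. odd_map_to (card (UNIV::'n set)) B g"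
  proof (rule odd_map_to_coords[of B "\<lambda>x. x"])
    show "\<exists>i\<in>UNIV. x $ i \<noteq> 0" if "x \<in> B" for x
    proof -
      have "x \<noteq> 0" using assms that by blast
      then show ?thesis by (simp add: vec_eq_iff)
    qed
  qed (auto intro: continuous_on_id)
  then show ?thesis
    unfolding kgenus_eq_Least by (rule LeastI)
qed

lemma kgenus_mono_map:
  fixes B B' :: "(real^'n::finite) set"
  assumes "continuous_on B h" and "\<And>x. x \<in> B \<Longrightarrow> h (-x) = - h x" and "h ` B \<subseteq> B'" and "0 \<notin> B'"
  shows "kgenus B \<le> kgenus B'"
proof -
  obtain g where g: "odd_map_to (kgenus B') B' g"
    using odd_map_to_kgenus[OF assms(4)] by blast
  have "odd_map_to (kgenus B') B (\<lambda>x. g (h x))"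
    using g assms continuous_on_compose2[of B' g B h]
    by (simp add: odd_map_to_def image_subset_iff)
  then show ?thesis by (rule kgenus_le)
qed

section \<open>The p-sphere and the genus of its coordinate subspheres\<close>

lemma zero_notin_p_sphere: "p > 0 \<Longrightarrow> 0 \<notin> p_sphere p"
  by (simp add: p_sphere_def)

lemma uminus_p_sphere [simp]: "- f \<in> p_sphere p \<longleftrightarrow> f \<in> p_sphere p"
  by (simp add: p_sphere_def)

lemma continuous_on_p_sum:
  "p > 0 \<Longrightarrow> continuous_on S (\<lambda>f::real^'n::finite. \<Sum>i\<in>UNIV. \<bar>f$i\<bar> powr p)"
  by (intro continuous_on_sum continuous_on_powr' continuous_intros) auto

lemma p_sum_pos:
  fixes u :: "real^'n::finite"
  assumes "u \<noteq> 0" shows "(\<Sum>i\<in>UNIV. \<bar>u$i\<bar> powr p) > 0"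
proof -
  obtain i where "u $ i \<noteq> 0" using assms by (auto simp: vec_eq_iff)
  then show ?thesis by (intro sum_pos2[of _ i]) auto
qed

lemma normalize_p_sphere:
  fixes u :: "real^'n::finite"
  assumes "u \<noteq> 0" "p > 0"
  shows "(\<Sum>i\<in>UNIV. \<bar>u$i\<bar> powr p) powr (-1/p) *\<^sub>R u \<in> p_sphere p"
proof -
  let ?N = "\<Sum>i\<in>UNIV. \<bar>u$i\<bar> powr p"
  have "?N > 0" by (rule p_sum_pos[OF assms(1)])
  have "(\<Sum>i\<in>UNIV. \<bar>(?N powr (-1/p) *\<^sub>R u) $ i\<bar> powr p) = (\<Sum>i\<in>UNIV. ?N powr (-1) * \<bar>u$i\<bar> powr p)"
    using assms(2) by (intro sum.cong refl) (simp add: abs_mult powr_mult powr_powr)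
  also have "\<dots> = ?N powr (-1) * ?N" by (simp only: sum_distrib_left)
  also have "\<dots> = 1" using \<open>?N > 0\<close> by (simp add: powr_minus)
  finally show ?thesis by (simp add: p_sphere_def)
qed

text \<open>If the genus were smaller, a witness composed with the odd map \<open>h\<close> from the
  Euclidean sphere of dimension \<open>card T - 1\<close> would contradict the Borsuk-Ulam
  theorem.\<close>

lemma kgenus_coord_sphere:
  fixes T :: "'n::finite set"
  assumes p: "p > 0"
  shows "card T \<le> kgenus {f \<in> p_sphere p. \<forall>i. i \<notin> T \<longrightarrow> f $ i = 0}" (is "_ \<le> kgenus ?B")
proof (rule ccontr)
  assume neg: "\<not> ?thesis"
  define n where "n = card T - 1"
  have n: "card T = Suc n" "kgenus ?B \<le> n" using neg by (auto simp: n_def)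
  have "card T \<le> CARD('n)" by (rule card_mono) auto
  then have dim: "n < CARD('n)" using n by simp
  obtain e where e: "bij_betw e T {0..<card T}"
    using ex_bij_betw_finite_nat[of T] by auto
  obtain g where g: "odd_map_to (kgenus ?B) ?B g"
    using odd_map_to_kgenus[of ?B] zero_notin_p_sphere[OF p] by auto
  define u where "u x = (\<chi> i. if i \<in> T then x (e i) else 0)" for x :: "nat \<Rightarrow> real"
  define h where "h x = (\<Sum>i\<in>UNIV. \<bar>u x$i\<bar> powr p) powr (-1/p) *\<^sub>R u x" for x
  have u0: "u x \<noteq> 0" if "x \<in> usphere n" for x
  proof
    assume "u x = 0"
    have "x k = 0" if k: "k \<le> n" for k
    proof -
      have "k \<in> e ` T"
        using e n(1) k by (simp add: bij_betw_def)
      then obtain i where "i \<in> T" "e i = k"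
        by blast
      moreover from \<open>u x = 0\<close> have "u x $ i = 0" by simp
      ultimately show ?thesis by (simp add: u_def)
    qed
    then show False using that by (simp add: usphere_def)
  qed
  have um: "u (\<lambda>i. - x i) = - u x" for x by (auto simp: u_def vec_eq_iff)
  have hB: "h x \<in> ?B" if "x \<in> usphere n" for x
    using normalize_p_sphere[OF u0[OF that] p] by (auto simp: h_def u_def)
  have hm: "h (\<lambda>i. - x i) = - h x" for x by (simp add: h_def um)
  have cu: "continuous_on S u" for S
    unfolding u_def
  proof (rule continuous_on_vec_lambda)
    show "continuous_on S (\<lambda>x. if i \<in> T then x (e i) else 0)" for i
      by (cases "i \<in> T") (auto intro: continuous_on_subset[OF continuous_on_product_coordinates])
  qed
  have "(\<Sum>i\<in>UNIV. \<bar>u x$i\<bar> powr p) \<noteq> 0" if "x \<in> usphere n" for x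
    using p_sum_pos[OF u0[OF that], of p] by simp
  then have ch: "continuous_on (usphere n) h"
    unfolding h_def
    by (intro continuous_on_scaleR cu continuous_on_powr continuous_on_const
        continuous_on_compose2[OF continuous_on_p_sum[OF p, of UNIV] cu]) auto
  have "\<exists>x\<in>usphere n. g (h x) = (\<lambda>i. 0)"
  proof (rule Borsuk_Ulam_usphere[OF dim])
    show "continuous_on (usphere n) (\<lambda>x. g (h x))"
      using continuous_on_compose2[OF _ ch] g hB unfolding odd_map_to_def by blast
    show "g (h (\<lambda>i. - x i)) = (\<lambda>i. - g (h x) i)" if "x \<in> usphere n" for x
      using g hB[OF that] unfolding odd_map_to_def hm by blast
    show "g (h x) i = 0" if "x \<in> usphere n" "n \<le> i" for x i
      using g hB[OF that(1)] le_trans[OF n(2) that(2)] unfolding odd_map_to_def by blast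
  qed
  then show False
    using g hB unfolding odd_map_to_def by blast
qed

section \<open>Inequalities for signed powers\<close>

text \<open>Keeping the sign makes the power odd, so that substituting it respects symmetric sets
  and their genus.\<close>

definition spow :: "real \<Rightarrow> real \<Rightarrow> real" where
  "spow r x = sgn x * \<bar>x\<bar> powr r"

lemma spow_uminus [simp]: "spow r (-x) = - spow r x"
  by (simp add: spow_def)

lemma abs_spow [simp]: "\<bar>spow r x\<bar> = \<bar>x\<bar> powr r"
  by (simp add: spow_def abs_mult abs_sgn_eq)

lemma spow_spow_inverse: "r \<noteq> 0 \<Longrightarrow> spow r (spow (1/r) x) = x"
  by (cases "x = 0") (auto simp: spow_def sgn_mult abs_mult abs_sgn_eq powr_powr sgn_if)

lemma continuous_on_spow:
  assumes "r > 0" shows "continuous_on S (spow r)"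
proof -
  \<comment> \<open>Powers of the positive and negative parts are continuous; this form avoids the
    jump of \<open>sgn\<close> at zero.\<close>
  have "spow r = (\<lambda>x. (max x 0) powr r - (max (-x) 0) powr r)"
    by (auto simp: spow_def fun_eq_iff sgn_if max_def)
  moreover have "continuous_on S (\<lambda>x. (max x 0) powr r - (max (-x) 0) powr r)"
    using assms by (intro continuous_intros continuous_on_powr') auto
  ultimately show ?thesis by simp
qed

text \<open>The library's \<open>powr_convex\<close> covers the open half-line only; the end point \<open>0\<close> matters here.\<close>
lemma powr_convex_combination:
  fixes x y \<theta> p :: real
  assumes "0 \<le> x" "0 \<le> y" "0 < \<theta>" "\<theta> < 1" "1 \<le> p"
  shows "(\<theta> * x + (1 - \<theta>) * y) powr p \<le> \<theta> * x powr p + (1 - \<theta>) * y powr p"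
proof -
  have le: "t powr p \<le> t" if "0 < t" "t < 1" for t :: real
    using powr_mono'[of 1 p t] that assms(5) by simp
  consider "x = 0" | "y = 0" | "x > 0" "y > 0" using assms by linarith
  then show ?thesis
  proof cases
    case 1
    then show ?thesis
      using assms le[of "1 - \<theta>"] by (simp add: powr_mult mult_right_mono)
  next
    case 2
    then show ?thesis
      using assms le[of \<theta>] by (simp add: powr_mult mult_right_mono)
  next
    case 3
    then show ?thesis
      using convex_onD[OF powr_convex[OF assms(5)], of "1 - \<theta>" x y] assms by simp
  qed
qed

text \<open>Convexity at \<open>a/\<theta>\<close> and \<open>b/(1 - \<theta>)\<close>. The weight
  \<open>\<theta>\<close> stays free so that it can be fitted to the number of leaves of a
  star.\<close>

lemma powr_add_le_weighted:
  fixes a b \<theta> p :: real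
  assumes "0 \<le> a" "0 \<le> b" "0 < \<theta>" "\<theta> < 1" "1 \<le> p"
  shows "(a + b) powr p \<le> \<theta> powr (1 - p) * a powr p + (1 - \<theta>) powr (1 - p) * b powr p"
proof -
  have *: "t * (c / t) powr p = t powr (1 - p) * c powr p" if "t > 0" "c \<ge> 0" for t c :: real
    using that by (simp add: powr_divide powr_diff)
  have "(a + b) powr p = (\<theta> * (a/\<theta>) + (1 - \<theta>) * (b/(1 - \<theta>))) powr p"
    using assms by simp
  also have "\<dots> \<le> \<theta> * (a/\<theta>) powr p + (1 - \<theta>) * (b/(1 - \<theta>)) powr p"
    using assms by (intro powr_convex_combination) auto
  finally show ?thesis
    using assms by (simp add: *)
qed

text \<open>After division by \<open>a\<close>, the numbers \<open>(a - b)/a\<close> and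
  \<open>b/a\<close> lie in the unit interval and add up to \<open>1\<close>; the power
  \<open>t\<close> does not decrease them.\<close>

lemma powr_diff_le:
  fixes a b t :: real
  assumes "0 \<le> b" "b \<le> a" "0 < t" "t \<le> 1"
  shows "a powr t - b powr t \<le> (a - b) powr t"
proof (cases "a = 0")
  case False
  then have a: "a > 0" using assms by linarith
  have le: "x \<le> x powr t" if "0 \<le> x" "x \<le> 1" for x :: real
    using powr_mono'[of t 1 x] that assms by simp
  have "1 = (a - b)/a + b/a" using a by (simp add: field_simps)
  also have "\<dots> \<le> ((a - b)/a) powr t + (b/a) powr t"
    using a assms by (intro add_mono le) auto
  also have "\<dots> = ((a - b) powr t + b powr t) / a powr t"
    using a assms by (simp add: powr_divide add_divide_distrib)
  finally show ?thesis using a by (simp add: field_simps)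
qed (use assms in auto)

text \<open>Midpoint convexity of the power \<open>1/t\<close> at \<open>a powr t\<close> and
  \<open>b powr t\<close>.\<close>

lemma powr_add_powr_le:
  fixes a b t :: real
  assumes "0 \<le> a" "0 \<le> b" "0 < t" "t \<le> 1"
  shows "a powr t + b powr t \<le> 2 powr (1 - t) * (a + b) powr t"
proof -
  have "((1/2) * a powr t + (1 - 1/2) * b powr t) powr (1/t)
      \<le> (1/2) * (a powr t) powr (1/t) + (1 - 1/2) * (b powr t) powr (1/t)"
    using assms by (intro powr_convex_combination) auto
  also have "\<dots> = (a + b) / 2"
    using assms by (simp add: powr_powr)
  finally have "(((1/2) * a powr t + (1 - 1/2) * b powr t) powr (1/t)) powr t \<le> ((a + b)/2) powr t"
    using assms by (intro powr_mono2) auto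
  then have "(a powr t + b powr t) / 2 \<le> ((a + b)/2) powr t"
    using assms by (simp add: powr_powr field_simps)
  also have "\<dots> = 2 powr (1 - t) * (a + b) powr t / 2"
    using assms by (simp add: powr_divide powr_diff)
  finally show ?thesis by simp
qed

text \<open>Equal signs reduce to \<open>powr_diff_le\<close>, opposite signs to
  \<open>powr_add_powr_le\<close>. The constant is sharp at \<open>v = -u\<close>.\<close>

lemma abs_spow_diff_le:
  assumes "0 < t" "t \<le> 1"
  shows "\<bar>spow t u - spow t v\<bar> \<le> 2 powr (1 - t) * \<bar>u - v\<bar> powr t"
proof -
  have one: "1 \<le> 2 powr (1 - t)" using assms by (simp add: ge_one_powr_ge_zero)
  have pos: "\<bar>spow t u - spow t v\<bar> \<le> 2 powr (1 - t) * \<bar>u - v\<bar> powr t" if "0 \<le> v" "v \<le> u" for u v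
  proof -
    have "\<bar>spow t u - spow t v\<bar> = u powr t - v powr t"
      using that assms powr_mono2[of t v u] by (auto simp: spow_def sgn_if)
    also have "\<dots> \<le> 1 * (u - v) powr t" using powr_diff_le[OF that assms] by simp
    also have "\<dots> \<le> 2 powr (1 - t) * (u - v) powr t"
      by (intro mult_right_mono one) auto
    finally show ?thesis using that by simp
  qed
  have opp: "\<bar>spow t u - spow t v\<bar> \<le> 2 powr (1 - t) * \<bar>u - v\<bar> powr t" if "v \<le> 0" "0 \<le> u" for u v
  proof -
    have "\<bar>spow t u - spow t v\<bar> = u powr t + (-v) powr t"
      using that by (auto simp: spow_def sgn_if)
    also have "\<dots> \<le> 2 powr (1 - t) * (u + (-v)) powr t"
      by (rule powr_add_powr_le) (use that assms in auto)
    finally show ?thesis using that by simp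
  qed
  consider "0 \<le> v" "v \<le> u" | "0 \<le> u" "u \<le> v" | "0 \<le> -v" "-v \<le> -u" | "0 \<le> -u" "-u \<le> -v"
    | "v \<le> 0" "0 \<le> u" | "u \<le> 0" "0 \<le> v" by linarith
  then show ?thesis
    by cases (use pos[of v u] pos[of u v] pos[of "-v" "-u"] pos[of "-u" "-v"] opp[of v u] opp[of u v]
        in \<open>auto simp: abs_minus_commute\<close>)
qed

text \<open>For \<open>t = p/q\<close> the constant of \<open>abs_spow_diff_le\<close>, raised to
  the power \<open>q\<close>, is \<open>2 powr (q - p)\<close>, exactly the change of the scaling
  factor. The monotonicity in \<open>p\<close> rests on this.\<close>

lemma spow_edge_contraction:
  assumes "0 < p" "p \<le> q"
  shows "2 powr (-q) * \<bar>spow (p/q) u - spow (p/q) v\<bar> powr q \<le> 2 powr (-p) * \<bar>u - v\<bar> powr p"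
proof -
  have "\<bar>spow (p/q) u - spow (p/q) v\<bar> powr q \<le> (2 powr (1 - p/q) * \<bar>u - v\<bar> powr (p/q)) powr q"
    using assms by (intro powr_mono2 abs_spow_diff_le) auto
  also have "\<dots> = 2 powr (q - p) * \<bar>u - v\<bar> powr p"
  proof -
    have "(1 - p/q) * q = q - p" "p/q * q = p"
      using assms by (auto simp: left_diff_distrib)
    then show ?thesis by (simp only: powr_mult powr_powr)
  qed
  finally have "2 powr (-q) * \<bar>spow (p/q) u - spow (p/q) v\<bar> powr q
      \<le> 2 powr (-q) * (2 powr (q - p) * \<bar>u - v\<bar> powr p)"
    by (intro mult_left_mono) auto
  then show ?thesis by (simp add: mult.assoc[symmetric] powr_add[symmetric])
qed

text \<open>For opposite signs \<open>\<bar>u - v\<bar> = \<bar>u\<bar> + \<bar>v\<bar>\<close>, and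
  the arithmetic-geometric mean inequality is raised to the power \<open>p/2\<close>; otherwise the
  left side is at most \<open>0\<close>.\<close>

lemma edge_term_ge:
  assumes "p > 0"
  shows "- (spow (p/2) u * spow (p/2) v) \<le> 2 powr (-p) * \<bar>u - v\<bar> powr p"
proof (cases "u * v < 0")
  case False
  then have "spow (p/2) u * spow (p/2) v \<ge> 0"
    by (auto simp: spow_def sgn_if mult_less_0_iff zero_le_mult_iff)
  then show ?thesis by (smt (verit) powr_ge_zero mult_nonneg_nonneg)
next
  case True
  have "\<bar>u\<bar> * \<bar>v\<bar> \<le> (\<bar>u - v\<bar> / 2) powr 2"
  proof -
    have "\<bar>u - v\<bar> = \<bar>u\<bar> + \<bar>v\<bar>" using True by (auto simp: mult_less_0_iff)
    moreover have "0 \<le> (\<bar>u\<bar> - \<bar>v\<bar>)\<^sup>2" by simp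
    ultimately show ?thesis
      by (simp add: power2_eq_square field_simps)
  qed
  then have "(\<bar>u\<bar> * \<bar>v\<bar>) powr (p/2) \<le> ((\<bar>u - v\<bar> / 2) powr 2) powr (p/2)"
    using assms by (intro powr_mono2) auto
  moreover have "((\<bar>u - v\<bar> / 2) powr 2) powr (p/2) = 2 powr (-p) * \<bar>u - v\<bar> powr p"
    unfolding powr_powr by (simp add: powr_divide powr_minus field_simps)
  moreover have "- (spow (p/2) u * spow (p/2) v) = (\<bar>u\<bar> * \<bar>v\<bar>) powr (p/2)"
    using True by (auto simp: spow_def sgn_if mult_less_0_iff powr_mult)
  ultimately show ?thesis by linarith
qed

text \<open>With \<open>c = ln m\<close> the base is \<open>1 + c/(2 * (p - 1))\<close> to first
  order, so its power tends to \<open>exp (c/2)\<close>.\<close>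

lemma star_constant_tendsto:
  assumes "m > (0::real)"
  shows "((\<lambda>p. ((1 + m powr (1/(p-1))) / 2) powr (p - 1) / 2) \<longlongrightarrow> sqrt m / 2) at_top"
proof -
  define c where "c = ln m"
  have "((\<lambda>p. ((1 + exp (c * (1/(p-1)))) / 2) powr (p - 1) / 2) \<longlongrightarrow> exp (c / 2) / 2) at_top"
    by real_asymp
  moreover have "exp (c / 2) = sqrt m"
    using assms by (simp add: c_def real_sqrt_eq_iff flip: powr_half_sqrt) (simp add: powr_def)
  ultimately show ?thesis
    using assms by (simp add: powr_def[of m] c_def mult.commute)
qed

section \<open>Variational and cut-off eigenvalues\<close>

definition vspow :: "real \<Rightarrow> real^'n::finite \<Rightarrow> real^'n" where
  "vspow r f = (\<chi> i. spow r (f $ i))"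

lemma vspow_nth [simp]: "vspow r f $ i = spow r (f $ i)"
  by (simp add: vspow_def)

lemma vspow_uminus [simp]: "vspow r (-f) = - vspow r f"
  by (simp add: vec_eq_iff)

lemma continuous_on_vspow_nth: "r > 0 \<Longrightarrow> continuous_on S (\<lambda>f. spow r (f $ i))"
  by (rule continuous_on_compose2[OF continuous_on_spow[of r UNIV]]) (auto intro!: continuous_intros)

lemma continuous_on_vspow: "r > 0 \<Longrightarrow> continuous_on S (vspow r)"
  unfolding vspow_def by (intro continuous_on_vec_lambda continuous_on_vspow_nth)

lemma vspow_in_p_sphere: "f \<in> p_sphere p \<Longrightarrow> q > 0 \<Longrightarrow> vspow (p/q) f \<in> p_sphere q"
  by (simp add: p_sphere_def powr_powr)

lemma sum_spow_squares: "f \<in> p_sphere p \<Longrightarrow> (\<Sum>i\<in>UNIV. (spow (p/2) (f $ i))\<^sup>2) = 1"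
proof -
  have "(spow (p/2) x)\<^sup>2 = \<bar>x\<bar> powr p" for x
    using abs_spow[of "p/2" x] by (metis power2_abs power2_eq_square powr_add field_sum_of_halves)
  then show "f \<in> p_sphere p \<Longrightarrow> ?thesis" by (simp add: p_sphere_def)
qed

lemma closed_p_sphere: "p > 0 \<Longrightarrow> closed (p_sphere p)"
  unfolding p_sphere_def by (intro closed_Collect_eq continuous_on_p_sum continuous_on_const)

lemma abs_le_1_p_sphere:
  assumes "f \<in> p_sphere p" "p > 0" shows "\<bar>f $ i\<bar> \<le> 1"
proof (rule ccontr)
  assume "\<not> ?thesis"
  then have "1 < \<bar>f $ i\<bar> powr p" using assms by (intro gr_one_powr) auto
  also have "\<dots> \<le> (\<Sum>i\<in>UNIV. \<bar>f$i\<bar> powr p)"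
    by (rule member_le_sum) auto
  finally show False using assms by (simp add: p_sphere_def)
qed

lemma compact_p_sphere:
  assumes "p > 0" shows "compact (p_sphere p :: (real^'n::finite) set)"
proof -
  have "norm f \<le> real CARD('n)" if "f \<in> p_sphere p" for f :: "real^'n"
    using norm_le_l1_cart[of f] sum_mono[of UNIV "\<lambda>i. \<bar>f $ i\<bar>" "\<lambda>_. 1"]
      abs_le_1_p_sphere[OF that assms] by simp
  then have "bounded (p_sphere p :: (real^'n) set)" by (auto simp: bounded_iff)
  then show ?thesis by (simp add: compact_eq_bounded_closed closed_p_sphere assms)
qed

lemma rayleigh_p_sphere:
  "f \<in> p_sphere p \<Longrightarrow> rayleigh E p f = (\<Sum>(i,j)\<in>E. \<bar>f$i - f$j\<bar> powr p) / 2"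
  by (simp add: rayleigh_def p_sphere_def)

lemma rayleigh_nonneg: "0 \<le> rayleigh E p f"
  unfolding rayleigh_def by (intro divide_nonneg_nonneg sum_nonneg) (auto intro!: sum_nonneg)

lemma bdd_above_rayleigh:
  assumes "p > 0" "B \<subseteq> p_sphere p" shows "bdd_above (rayleigh E p ` B)"
proof (rule bdd_aboveI2)
  fix f assume "f \<in> B"
  then have f: "f \<in> p_sphere p" using assms by blast
  have "\<bar>f$i - f$j\<bar> powr p \<le> 2 powr p" for i j
    using abs_le_1_p_sphere[OF f assms(1), of i] abs_le_1_p_sphere[OF f assms(1), of j] assms(1)
    by (intro powr_mono2) auto
  then have "(\<Sum>(i,j)\<in>E. \<bar>f$i - f$j\<bar> powr p) \<le> (\<Sum>(i,j)\<in>E. 2 powr p)"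
    by (intro sum_mono) auto
  then show "rayleigh E p f \<le> (\<Sum>(i,j)\<in>E. 2 powr p) / 2"
    by (simp add: rayleigh_p_sphere[OF f])
qed

lemma rayleigh_vspow_le:
  assumes "f \<in> p_sphere p" "0 < p" "p \<le> q"
  shows "2 powr (-q) * rayleigh E q (vspow (p/q) f) \<le> 2 powr (-p) * rayleigh E p f"
proof -
  have "(\<Sum>(i,j)\<in>E. 2 powr (-q) * \<bar>spow (p/q) (f$i) - spow (p/q) (f$j)\<bar> powr q)
      \<le> (\<Sum>(i,j)\<in>E. 2 powr (-p) * \<bar>f$i - f$j\<bar> powr p)"
    by (intro sum_mono) (auto intro: spow_edge_contraction[OF assms(2,3)])
  then show ?thesis
    using assms by (simp add: rayleigh_p_sphere vspow_in_p_sphere split_beta sum_distrib_left)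
qed

text \<open>\<open>edge_term_ge\<close> is summed over \<open>F\<close> and the other edge terms are
  dropped as nonnegative, so a few well-chosen edges give a lower bound.\<close>

lemma rayleigh_ge:
  assumes "f \<in> p_sphere p" "0 < p" "F \<subseteq> E"
  shows "- (\<Sum>(i,j)\<in>F. spow (p/2) (f$i) * spow (p/2) (f$j)) / 2 \<le> 2 powr (-p) * rayleigh E p f"
proof -
  have "- (\<Sum>(i,j)\<in>F. spow (p/2) (f$i) * spow (p/2) (f$j))
      \<le> (\<Sum>(i,j)\<in>F. 2 powr (-p) * \<bar>f$i - f$j\<bar> powr p)"
    unfolding sum_negf[symmetric] by (intro sum_mono) (auto intro: edge_term_ge[OF assms(2)])
  also have "\<dots> \<le> (\<Sum>(i,j)\<in>E. 2 powr (-p) * \<bar>f$i - f$j\<bar> powr p)"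
    by (rule sum_mono2) (use assms in auto)
  finally show ?thesis
    using assms by (simp add: rayleigh_p_sphere split_beta sum_distrib_left)
qed

lemma coord_sphere_in_genus_family:
  fixes T :: "'n::finite set"
  assumes "p > 0" "k \<le> card T"
  shows "{f \<in> p_sphere p. \<forall>i. i \<notin> T \<longrightarrow> f $ i = 0} \<in> genus_family k p" (is "?B \<in> _")
proof -
  have "closed (p_sphere p \<inter> (\<Inter>i\<in>-T. {f::real^'n. f $ i = 0}))"
    by (intro closed_Int closed_INT ballI closed_p_sphere assms closed_Collect_eq continuous_intros)
  also have "p_sphere p \<inter> (\<Inter>i\<in>-T. {f::real^'n. f $ i = 0}) = ?B" by auto
  finally show ?thesis
    using kgenus_coord_sphere[OF assms(1), of T] assms(2) by (auto simp: genus_family_def)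
qed

lemma p_sphere_in_genus_family:
  "p > 0 \<Longrightarrow> k \<le> CARD('n) \<Longrightarrow> (p_sphere p :: (real^'n::finite) set) \<in> genus_family k p"
  using coord_sphere_in_genus_family[of p k "UNIV :: 'n set"] by simp

text \<open>Otherwise the coordinates of \<open>\<phi>\<close> in \<open>T\<close> would bound the
  genus by \<open>card T\<close>. Large genus enters the lower bounds in this form.\<close>

lemma genus_family_zero:
  fixes \<phi> :: "real^'n::finite \<Rightarrow> real^'n"
  assumes "B \<in> genus_family k p" "continuous_on B \<phi>" "\<And>x. \<phi> (-x) = - \<phi> x" "card T < k"
  shows "\<exists>f\<in>B. \<forall>i\<in>T. \<phi> f $ i = 0"
  using kgenus_le_card[of B \<phi> T] assms unfolding genus_family_def by fastforce

text \<open>The case of no conditions, \<open>T = {}\<close>. It ensures that each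
  \<open>SUP\<close> over a member of the family is a genuine supremum.\<close>

lemma genus_family_nonempty: "B \<in> genus_family k p \<Longrightarrow> 1 \<le> k \<Longrightarrow> B \<noteq> {}"
  using genus_family_zero[of B k p "\<lambda>x. x" "{}"] by (auto intro: continuous_on_id)

lemma var_eigenvalue_le_SUP:
  fixes E :: "('n::finite \<times> 'n) set"
  assumes "B \<in> genus_family k p" "1 \<le> k" "p > 0"
  shows "var_eigenvalue E k p \<le> (SUP f\<in>B. rayleigh E p f)"
  unfolding var_eigenvalue_def
proof (rule cINF_lower[OF _ assms(1)], rule bdd_belowI2)
  fix A :: "(real^'n) set" assume A: "A \<in> genus_family k p"
  then obtain f where "f \<in> A" using genus_family_nonempty assms by blast
  then have "rayleigh E p f \<le> (SUP f\<in>A. rayleigh E p f)"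
    using A assms by (intro cSUP_upper bdd_above_rayleigh) (auto simp: genus_family_def)
  then show "0 \<le> (SUP f\<in>A. rayleigh E p f)"
    using rayleigh_nonneg[of E p f] by linarith
qed

lemma var_eigenvalue_le:
  assumes "B \<in> genus_family k p" "1 \<le> k" "p > 0" "\<And>f. f \<in> B \<Longrightarrow> rayleigh E p f \<le> c"
  shows "var_eigenvalue E k p \<le> c"
  using var_eigenvalue_le_SUP[OF assms(1-3), of E]
    cSUP_least[OF genus_family_nonempty[OF assms(1,2)] assms(4)] by (rule order_trans)

lemma var_eigenvalue_ge:
  fixes E :: "('n::finite \<times> 'n) set"
  assumes "k \<le> CARD('n)" "p > 0"
    and "\<And>B. B \<in> genus_family k p \<Longrightarrow> \<exists>f\<in>B. c \<le> rayleigh E p f"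
  shows "c \<le> var_eigenvalue E k p"
  unfolding var_eigenvalue_def
proof (rule cINF_greatest)
  show "(genus_family k p :: (real^'n) set set) \<noteq> {}"
    using p_sphere_in_genus_family[OF assms(2,1)] by blast
  fix B :: "(real^'n) set" assume B: "B \<in> genus_family k p"
  then obtain f where f: "f \<in> B" "c \<le> rayleigh E p f" using assms(3) by blast
  have "rayleigh E p f \<le> (SUP f\<in>B. rayleigh E p f)"
    using B assms f by (intro cSUP_upper bdd_above_rayleigh) (auto simp: genus_family_def)
  with f show "c \<le> (SUP f\<in>B. rayleigh E p f)" by linarith
qed

lemma var_eigenvalue_nonneg:
  fixes E :: "('n::finite \<times> 'n) set"
  assumes "1 \<le> k" "k \<le> CARD('n)" "p > 0"
  shows "0 \<le> var_eigenvalue E k p"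
  using genus_family_nonempty assms rayleigh_nonneg by (intro var_eigenvalue_ge) blast+

text \<open>The image is closed because \<open>B\<close> is compact, and the genus cannot drop
  because witnesses pull back along odd maps.\<close>

lemma vspow_genus_family:
  assumes B: "B \<in> genus_family k p" and "0 < p" "0 < q"
  shows "vspow (p/q) ` B \<in> genus_family k q"
proof -
  have B': "closed B" "B \<subseteq> p_sphere p" "\<And>x. x \<in> B \<Longrightarrow> -x \<in> B" "k \<le> kgenus B"
    using B by (auto simp: genus_family_def)
  have cont: "continuous_on B (vspow (p/q))"
    using assms by (intro continuous_on_vspow) auto
  have im: "vspow (p/q) ` B \<subseteq> p_sphere q"
    using B' assms by (auto intro: vspow_in_p_sphere)
  have "compact B"
    using compact_Int_closed[OF compact_p_sphere[OF assms(2)] B'(1)] B'(2) by (simp add: Int_absorb1)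
  then have "closed (vspow (p/q) ` B)"
    using cont by (intro compact_imp_closed compact_continuous_image)
  moreover have "kgenus B \<le> kgenus (vspow (p/q) ` B)"
    by (rule kgenus_mono_map[OF cont]) (use im zero_notin_p_sphere[OF assms(3)] in auto)
  moreover have "- y \<in> vspow (p/q) ` B" if "y \<in> vspow (p/q) ` B" for y
    using that B'(3) by (metis (no_types, lifting) imageE image_eqI vspow_uminus)
  ultimately show ?thesis
    using im B'(4) by (simp add: genus_family_def)
qed

text \<open>\<open>vspow (p/q)\<close> carries every set competing at \<open>p\<close> to one
  competing at \<open>q\<close> on which the scaled quotient is no larger.\<close>

lemma scaled_var_eigenvalue_antimono:
  fixes E :: "('n::finite \<times> 'n) set"
  assumes k: "1 \<le> k" "k \<le> CARD('n)" and p: "0 < p" "p \<le> q"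
  shows "2 powr (-q) * var_eigenvalue E k q \<le> 2 powr (-p) * var_eigenvalue E k p"
proof -
  have "2 powr p * (2 powr (-q) * var_eigenvalue E k q) \<le> var_eigenvalue E k p"
    unfolding var_eigenvalue_def[of E k p]
  proof (rule cINF_greatest)
    show "(genus_family k p :: (real^'n) set set) \<noteq> {}"
      using p_sphere_in_genus_family[OF p(1) k(2)] by blast
    fix B :: "(real^'n) set" assume B: "B \<in> genus_family k p"
    have "var_eigenvalue E k q \<le> 2 powr q * (2 powr (-p) * (SUP f\<in>B. rayleigh E p f))"
    proof (rule var_eigenvalue_le[OF vspow_genus_family[OF B, of q] k(1)])
      fix g assume "g \<in> vspow (p/q) ` B"
      then obtain f where f: "f \<in> B" "g = vspow (p/q) f" by blast
      have fp: "f \<in> p_sphere p" using B f by (auto simp: genus_family_def)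
      have "rayleigh E p f \<le> (SUP f\<in>B. rayleigh E p f)"
        using B p f by (intro cSUP_upper bdd_above_rayleigh) (auto simp: genus_family_def)
      then have "2 powr (-p) * rayleigh E p f \<le> 2 powr (-p) * (SUP f\<in>B. rayleigh E p f)"
        by (intro mult_left_mono) auto
      with rayleigh_vspow_le[OF fp p, of E]
      have "2 powr (-q) * rayleigh E q g \<le> 2 powr (-p) * (SUP f\<in>B. rayleigh E p f)"
        unfolding f(2) by (rule order_trans)
      then have "2 powr q * (2 powr (-q) * rayleigh E q g) \<le> 2 powr q * (2 powr (-p) * (SUP f\<in>B. rayleigh E p f))"
        by (intro mult_left_mono) auto
      then show "rayleigh E q g \<le> 2 powr q * (2 powr (-p) * (SUP f\<in>B. rayleigh E p f))"
        by (simp add: mult.assoc[symmetric] powr_add[symmetric])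
    qed (use p in auto)
    then show "2 powr p * (2 powr (-q) * var_eigenvalue E k q) \<le> (SUP f\<in>B. rayleigh E p f)"
      by (simp add: powr_minus field_simps)
  qed
  then show ?thesis by (simp add: powr_minus field_simps)
qed

text \<open>A decreasing function bounded below by \<open>0\<close> tends to its infimum, so
  \<open>Lim\<close> in \<open>cutoff_eig\<close> denotes an actual limit.\<close>

lemma scaled_var_eigenvalue_convergent:
  fixes E :: "('n::finite \<times> 'n) set"
  assumes k: "1 \<le> k" "k \<le> CARD('n)"
  shows "((\<lambda>p. 2 powr (-p) * var_eigenvalue E k p) \<longlongrightarrow> cutoff_eig E k) at_top"
proof -
  let ?f = "\<lambda>p. 2 powr (-p) * var_eigenvalue E k p"
  have nn: "0 \<le> ?f p" if "p \<in> {1..}" for p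
    using var_eigenvalue_nonneg[OF k, of p E] that by simp
  have bdd: "bdd_below (?f ` {1..})"
    using nn by (rule bdd_belowI2)
  have "(?f \<longlongrightarrow> (INF p\<in>{1..}. ?f p)) at_top"
  proof (rule decreasing_tendsto)
    show "\<forall>\<^sub>F p in at_top. (INF p\<in>{1..}. ?f p) \<le> ?f p"
      by (rule eventually_at_top_linorderI[of 1]) (intro cINF_lower bdd, simp)
    fix x assume "(INF p\<in>{1..}. ?f p) < x"
    then obtain q where q: "1 \<le> q" "?f q < x"
      using cINF_less_iff[of "{1..}" ?f x] bdd by auto
    show "\<forall>\<^sub>F p in at_top. ?f p < x"
    proof (rule eventually_at_top_linorderI[of q])
      fix p assume "q \<le> p"
      then show "?f p < x"
        using scaled_var_eigenvalue_antimono[OF k, of q p E] q by simp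
    qed
  qed
  then show ?thesis
    unfolding cutoff_eig_def using tendsto_Lim[of "at_top :: real filter" ?f] by simp
qed

lemma cutoff_eig_eqI:
  "((\<lambda>p. 2 powr (-p) * var_eigenvalue E k p) \<longlongrightarrow> l) at_top \<Longrightarrow> cutoff_eig E k = l"
  unfolding cutoff_eig_def by (rule tendsto_Lim) simp_all

section \<open>Graphs with a vanishing next-to-last cut-off eigenvalue\<close>

lemma cutoff_eig_ge:
  fixes E :: "('n::finite \<times> 'n) set"
  assumes k: "1 \<le> k" "k \<le> CARD('n)"
    and "\<And>p B. \<lbrakk>p \<ge> 1; B \<in> genus_family k p\<rbrakk> \<Longrightarrow> \<exists>f\<in>B. c \<le> 2 powr (-p) * rayleigh E p f"
  shows "c \<le> cutoff_eig E k"
proof (rule tendsto_lowerbound[OF scaled_var_eigenvalue_convergent[OF k]])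
  have "c \<le> 2 powr (-p) * var_eigenvalue E k p" if "p \<ge> 1" for p
  proof -
    have eq: "c \<le> 2 powr (-p) * y \<longleftrightarrow> 2 powr p * c \<le> y" for y
      by (simp add: powr_minus field_simps)
    show ?thesis
      unfolding eq using assms(3)[OF that] that unfolding eq by (intro var_eigenvalue_ge k) auto
  qed
  then show "\<forall>\<^sub>F p in at_top. c \<le> 2 powr (-p) * var_eigenvalue E k p"
    by (auto intro: eventually_at_top_linorderI[of 1])
qed simp

lemma cutoff_eig_ge_half_of_disjoint_edges:
  fixes E :: "('n::finite \<times> 'n) set"
  assumes E: "{(a,b), (b,a), (c,d), (d,c)} \<subseteq> E" and dist: "distinct [a, b, c, d]"
  shows "1/2 \<le> cutoff_eig E (CARD('n) - 1)"
proof (rule cutoff_eig_ge)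
  have four: "4 \<le> CARD('n)"
    using card_mono[of "UNIV :: 'n set" "{a,b,c,d}"] dist by simp
  then show "1 \<le> CARD('n) - 1" "CARD('n) - 1 \<le> CARD('n)" by auto
  fix p :: real and B :: "(real^'n) set"
  assume p: "p \<ge> 1" and B: "B \<in> genus_family (CARD('n) - 1) p"
  define y where "y f i = spow (p/2) (f $ i)" for f :: "real^'n" and i
  \<comment> \<open>The coordinates at \<open>a\<close> and \<open>c\<close> hold the sums over the
    two edges; ignoring \<open>b\<close> and \<open>d\<close> leaves \<open>CARD('n) - 2\<close>
    conditions.\<close>
  define \<phi> where "\<phi> f = (\<chi> i. if i = a then y f a + y f b else if i = c then y f c + y f d else y f i)" for f
  have cy: "continuous_on B (\<lambda>f. y f i)" for i
    unfolding y_def using p by (intro continuous_on_vspow_nth) auto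
  have "continuous_on B (\<lambda>f. if i = a then y f a + y f b else if i = c then y f c + y f d else y f i)" for i
    by (cases "i = a"; cases "i = c") (auto intro!: continuous_on_add cy)
  then have "continuous_on B \<phi>"
    unfolding \<phi>_def by (rule continuous_on_vec_lambda)
  moreover have "\<phi> (-f) = - \<phi> f" for f
    by (simp add: \<phi>_def y_def vec_eq_iff)
  moreover have "card (UNIV - {b, d}) < CARD('n) - 1"
    using dist four by (simp add: card_Diff_subset)
  ultimately obtain f where f: "f \<in> B" "\<forall>i\<in>UNIV - {b, d}. \<phi> f $ i = 0"
    using genus_family_zero[OF B] by blast
  have fp: "f \<in> p_sphere p" using f B by (auto simp: genus_family_def)
  have zero: "y f i = 0" if "i \<notin> {a,b,c,d}" for i
    using f(2)[rule_format, of i] that by (auto simp: \<phi>_def)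
  have rel: "y f b = - y f a" "y f d = - y f c"
    using f(2)[rule_format, of a] f(2)[rule_format, of c] dist by (auto simp: \<phi>_def)
  have "1 = (\<Sum>i\<in>UNIV. (y f i)\<^sup>2)" using sum_spow_squares[OF fp] by (simp add: y_def)
  also have "\<dots> = (\<Sum>i\<in>{a,b,c,d}. (y f i)\<^sup>2)"
    using zero by (intro sum.mono_neutral_right) auto
  also have "\<dots> = 2 * (y f a)\<^sup>2 + 2 * (y f c)\<^sup>2" using dist by (simp add: rel)
  \<comment> \<open>Each edge counts twice, so the left side is
    \<open>(y f a)\<^sup>2 + (y f c)\<^sup>2\<close>, half of the total mass
    \<open>1\<close>.\<close>
  finally have "- (\<Sum>(i,j)\<in>{(a,b), (b,a), (c,d), (d,c)}. y f i * y f j) / 2 = 1/2"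
    using dist by (simp add: rel power2_eq_square)
  moreover have "- (\<Sum>(i,j)\<in>{(a,b), (b,a), (c,d), (d,c)}. y f i * y f j) / 2 \<le> 2 powr (-p) * rayleigh E p f"
    using rayleigh_ge[OF fp _ E] p unfolding y_def by simp
  ultimately show "\<exists>f\<in>B. 1/2 \<le> 2 powr (-p) * rayleigh E p f" using f(1) by auto
qed

lemma cutoff_eig_ge_half_of_triangle:
  fixes E :: "('n::finite \<times> 'n) set"
  assumes E: "{(a,b), (b,a), (b,c), (c,b), (a,c), (c,a)} \<subseteq> E" and dist: "distinct [a, b, c]"
  shows "1/2 \<le> cutoff_eig E (CARD('n) - 1)"
proof (rule cutoff_eig_ge)
  have three: "3 \<le> CARD('n)"
    using card_mono[of "UNIV :: 'n set" "{a,b,c}"] dist by simp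
  then show "1 \<le> CARD('n) - 1" "CARD('n) - 1 \<le> CARD('n)" by auto
  fix p :: real and B :: "(real^'n) set"
  assume p: "p \<ge> 1" and B: "B \<in> genus_family (CARD('n) - 1) p"
  define y where "y f i = spow (p/2) (f $ i)" for f :: "real^'n" and i
  \<comment> \<open>The coordinate at \<open>a\<close> holds the sum over the triangle, and
    \<open>b\<close> and \<open>c\<close> are ignored.\<close>
  define \<phi> where "\<phi> f = (\<chi> i. if i = a then y f a + y f b + y f c else y f i)" for f
  have cy: "continuous_on B (\<lambda>f. y f i)" for i
    unfolding y_def using p by (intro continuous_on_vspow_nth) auto
  have "continuous_on B (\<lambda>f. if i = a then y f a + y f b + y f c else y f i)" for i
    by (cases "i = a") (auto intro!: continuous_on_add cy)
  then have "continuous_on B \<phi>"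
    unfolding \<phi>_def by (rule continuous_on_vec_lambda)
  moreover have "\<phi> (-f) = - \<phi> f" for f
    by (simp add: \<phi>_def y_def vec_eq_iff)
  moreover have "card (UNIV - {b, c}) < CARD('n) - 1"
    using dist three by (simp add: card_Diff_subset)
  ultimately obtain f where f: "f \<in> B" "\<forall>i\<in>UNIV - {b, c}. \<phi> f $ i = 0"
    using genus_family_zero[OF B] by blast
  have fp: "f \<in> p_sphere p" using f B by (auto simp: genus_family_def)
  have zero: "y f i = 0" if "i \<notin> {a,b,c}" for i
    using f(2)[rule_format, of i] that by (auto simp: \<phi>_def)
  have rel: "y f c = - y f a - y f b"
    using f(2)[rule_format, of a] dist by (auto simp: \<phi>_def)
  have "1 = (\<Sum>i\<in>UNIV. (y f i)\<^sup>2)" using sum_spow_squares[OF fp] by (simp add: y_def)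
  also have "\<dots> = (\<Sum>i\<in>{a,b,c}. (y f i)\<^sup>2)"
    using zero by (intro sum.mono_neutral_right) auto
  finally have "(y f a)\<^sup>2 + (y f b)\<^sup>2 + (y f c)\<^sup>2 = 1" using dist by simp
  \<comment> \<open>Since \<open>y f a + y f b + y f c\<close> vanishes, so does its square, and the
    three pairwise products add up to \<open>-1/2\<close>.\<close>
  then have "- (\<Sum>(i,j)\<in>{(a,b), (b,a), (b,c), (c,b), (a,c), (c,a)}. y f i * y f j) / 2 = 1/2"
    using dist dist[THEN distinct_rev[THEN iffD2]] by (simp add: rel power2_eq_square algebra_simps)
  moreover have "- (\<Sum>(i,j)\<in>{(a,b), (b,a), (b,c), (c,b), (a,c), (c,a)}. y f i * y f j) / 2
      \<le> 2 powr (-p) * rayleigh E p f"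
    using rayleigh_ge[OF fp _ E] p unfolding y_def by simp
  ultimately show "\<exists>f\<in>B. 1/2 \<le> 2 powr (-p) * rayleigh E p f" using f(1) by auto
qed

text \<open>Any two edges meet. Without a common vertex, an edge avoiding \<open>a\<close> passes
  through \<open>b\<close> and an edge avoiding \<open>b\<close> passes through \<open>a\<close>; as
  these two meet, they close a triangle.\<close>

lemma intersecting_edges_star:
  fixes E :: "('n::finite \<times> 'n) set"
  assumes G: "simple_graph E" and ne: "E \<noteq> {}"
    and no2: "\<And>a b c d. {(a,b), (b,a), (c,d), (d,c)} \<subseteq> E \<Longrightarrow> \<not> distinct [a, b, c, d]"
    and no3: "\<And>a b c. {(a,b), (b,a), (b,c), (c,b), (a,c), (c,a)} \<subseteq> E \<Longrightarrow> \<not> distinct [a, b, c]"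
  shows "\<exists>m. star_plus_isolated E m"
proof -
  have sy: "(y, x) \<in> E" if "(x, y) \<in> E" for x y
    using G that by (auto simp: simple_graph_def sym_def)
  have ir: "x \<noteq> y" if "(x, y) \<in> E" for x y
    using G that by (auto simp: simple_graph_def irrefl_def)
  obtain a b where ab: "(a, b) \<in> E" using ne by auto
  have meet: "x \<in> {u, v} \<or> y \<in> {u, v}" if "(u, v) \<in> E" "(x, y) \<in> E" for u v x y
    using no2[of u v x y] that ir[OF that(1)] ir[OF that(2)] sy[OF that(1)] sy[OF that(2)] by auto
  have "\<exists>c. \<forall>x y. (x, y) \<in> E \<longrightarrow> x = c \<or> y = c"
  proof (rule ccontr)
    assume no: "\<nexists>c. \<forall>x y. (x, y) \<in> E \<longrightarrow> x = c \<or> y = c"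
    then obtain x y where "(x, y) \<in> E" "x \<noteq> a" "y \<noteq> a" by blast
    then obtain x where x: "(b, x) \<in> E" "x \<noteq> a"
      using meet[OF ab \<open>(x, y) \<in> E\<close>] sy by auto
    obtain u v where "(u, v) \<in> E" "u \<noteq> b" "v \<noteq> b" using no by blast
    then obtain v where v: "(a, v) \<in> E" "v \<noteq> b"
      using meet[OF ab \<open>(u, v) \<in> E\<close>] sy by auto
    have "v = x" using meet[OF x(1) v(1)] v(2) x(2) ir[OF ab] by auto
    then show False
      using no3[of a b x] ab x v sy ir by auto
  qed
  then obtain c where c: "\<And>x y. (x, y) \<in> E \<Longrightarrow> x = c \<or> y = c" by blast
  define S where "S = {s. (c, s) \<in> E}"
  have "c \<notin> S" using ir by (auto simp: S_def)
  moreover have "E = {(c,s) | s. s \<in> S} \<union> {(s,c) | s. s \<in> S}"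
  proof (rule Set.set_eqI)
    fix z :: "'n \<times> 'n"
    obtain x y where "z = (x, y)" by (cases z)
    then show "z \<in> E \<longleftrightarrow> z \<in> {(c,s) | s. s \<in> S} \<union> {(s,c) | s. s \<in> S}"
      using c[of x y] sy[of x y] sy[of y x] by (auto simp: S_def)
  qed
  moreover have "card S \<ge> 1"
  proof -
    have "S \<noteq> {}" using ab c[OF ab] sy[OF ab] by (auto simp: S_def)
    then show ?thesis by (simp add: Suc_le_eq card_gt_0_iff)
  qed
  ultimately show ?thesis
    unfolding star_plus_isolated_def by blast
qed

lemma sum_star_edges:
  fixes S :: "'n::finite set"
  assumes "c \<notin> S"
  shows "(\<Sum>(i,j)\<in>{(c,s) | s. s \<in> S} \<union> {(s,c) | s. s \<in> S}. h i j) = (\<Sum>s\<in>S. h c s + h s c :: real)"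
proof -
  have 1: "{(c,s) | s. s \<in> S} = Pair c ` S" and 2: "{(s,c) | s. s \<in> S} = (\<lambda>s. (s, c)) ` S"
    by auto
  have "(\<Sum>(i,j)\<in>Pair c ` S \<union> (\<lambda>s. (s, c)) ` S. h i j)
      = (\<Sum>(i,j)\<in>Pair c ` S. h i j) + (\<Sum>(i,j)\<in>(\<lambda>s. (s, c)) ` S. h i j)"
    using assms by (intro sum.union_disjoint) auto
  also have "\<dots> = (\<Sum>s\<in>S. h c s) + (\<Sum>s\<in>S. h s c)"
    by (simp add: sum.reindex inj_on_def)
  finally show ?thesis by (simp only: 1 2 sum.distrib)
qed

text \<open>An odd linear map whose kernel is the line through \<open>f\<close> must vanish
  somewhere on \<open>B\<close>. That line meets the sphere only in \<open>f\<close> and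
  \<open>-f\<close>, and \<open>B\<close> is symmetric.\<close>

lemma genus_family_full:
  fixes B :: "(real^'n::finite) set"
  assumes B: "B \<in> genus_family CARD('n) p" and p: "p > 0" and f: "f \<in> p_sphere p"
  shows "f \<in> B"
proof -
  have "f \<noteq> 0" using f zero_notin_p_sphere[OF p] by blast
  then obtain j where j: "f $ j \<noteq> 0" by (auto simp: vec_eq_iff)
  \<comment> \<open>Coordinate \<open>j\<close> of \<open>\<phi>\<close> is identically zero, so
    only \<open>CARD('n) - 1\<close> conditions remain.\<close>
  define \<phi> where "\<phi> x = (\<chi> i. x $ i - x $ j * (f $ i / f $ j))" for x :: "real^'n"
  have "continuous_on B \<phi>"
    unfolding \<phi>_def by (intro continuous_on_vec_lambda continuous_on_diff continuous_on_mult
        continuous_on_const continuous_on_component continuous_on_id)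
  moreover have "\<phi> (-x) = - \<phi> x" for x
    by (simp add: \<phi>_def vec_eq_iff)
  moreover have "card (UNIV - {j}) < CARD('n)"
    by (rule psubset_card_mono) auto
  ultimately obtain x where x: "x \<in> B" "\<forall>i\<in>UNIV - {j}. \<phi> x $ i = 0"
    using genus_family_zero[OF B] by blast
  have eq: "x $ i = (x $ j / f $ j) * f $ i" for i
    using x(2) j by (cases "i = j") (auto simp: \<phi>_def field_simps)
  let ?t = "x $ j / f $ j"
  have "1 = (\<Sum>i\<in>UNIV. \<bar>x $ i\<bar> powr p)"
    using x(1) B by (auto simp: genus_family_def p_sphere_def)
  also have "\<dots> = (\<Sum>i\<in>UNIV. \<bar>?t\<bar> powr p * \<bar>f $ i\<bar> powr p)"
    by (subst eq) (simp only: abs_mult powr_mult)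
  also have "\<dots> = \<bar>?t\<bar> powr p"
    using f by (simp add: p_sphere_def flip: sum_distrib_left)
  finally have "\<bar>?t\<bar> powr p = 1" by simp
  then have "\<bar>?t\<bar> = 1"
    using p powr_eq_one_iff_gen[of "\<bar>?t\<bar>" p] by (cases "?t = 0") auto
  then have "?t = 1 \<or> ?t = -1" by linarith
  then have "x = f \<or> x = - f"
  proof
    assume "?t = 1"
    then have "x $ i = f $ i" for i using eq[of i] by simp
    then show ?thesis by (simp add: vec_eq_iff)
  next
    assume "?t = -1"
    then have "x $ i = - f $ i" for i using eq[of i] by simp
    then show ?thesis by (simp add: vec_eq_iff)
  qed
  then show ?thesis
    using x(1) B by (auto simp: genus_family_def)
qed

section \<open>Cut-off eigenvalues of a star\<close>

context
  fixes E :: "('n::finite \<times> 'n) set" and c :: 'n and S :: "'n set" and m :: nat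
  assumes cS: "c \<notin> S" and cardS: "card S = m" and m: "m \<ge> 1"
    and E: "E = {(c,s) | s. s \<in> S} \<union> {(s,c) | s. s \<in> S}"
begin

lemma star_rayleigh:
  "f \<in> p_sphere p \<Longrightarrow> rayleigh E p f = (\<Sum>s\<in>S. \<bar>f$c - f$s\<bar> powr p)"
  unfolding E by (simp add: rayleigh_p_sphere sum_star_edges[OF cS] abs_minus_commute
      sum_divide_distrib)

lemma star_cutoff_eig_eq_0:
  assumes k: "1 \<le> k" "k < CARD('n)"
  shows "cutoff_eig E k = 0"
proof (rule cutoff_eig_eqI, rule tendsto_sandwich)
  let ?B = "\<lambda>p. {f \<in> p_sphere p. \<forall>i. i \<notin> UNIV - {c} \<longrightarrow> f $ i = 0}"
  have "var_eigenvalue E k p \<le> 1" if p: "p \<ge> 1" for p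
  proof (rule var_eigenvalue_le)
    show "?B p \<in> genus_family k p"
      using p k by (intro coord_sphere_in_genus_family) (auto simp: card_Diff_subset)
    fix f assume "f \<in> ?B p"
    then have f: "f \<in> p_sphere p" "f $ c = 0" by auto
    have "rayleigh E p f = (\<Sum>s\<in>S. \<bar>f$s\<bar> powr p)"
      using f by (simp add: star_rayleigh)
    also have "\<dots> \<le> (\<Sum>s\<in>UNIV. \<bar>f$s\<bar> powr p)"
      by (rule sum_mono2) auto
    finally show "rayleigh E p f \<le> 1" using f by (simp add: p_sphere_def)
  qed (use p k in auto)
  then have "2 powr (-p) * var_eigenvalue E k p \<le> 2 powr (-p)" if "p \<ge> 1" for p
    using that mult_left_mono[of "var_eigenvalue E k p" 1 "2 powr (-p)"] by simp
  then show "\<forall>\<^sub>F p in at_top. 2 powr (-p) * var_eigenvalue E k p \<le> 2 powr (-p)"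
    by (auto intro: eventually_at_top_linorderI[of 1])
  have "0 \<le> 2 powr (-p) * var_eigenvalue E k p" if "p \<ge> 1" for p
    using var_eigenvalue_nonneg[of k p E] k that by simp
  then show "\<forall>\<^sub>F p in at_top. 0 \<le> 2 powr (-p) * var_eigenvalue E k p"
    by (auto intro: eventually_at_top_linorderI[of 1])
  show "((\<lambda>p. 2 powr (-p)) \<longlongrightarrow> (0::real)) at_top" by real_asymp
qed simp

lemma star_cutoff_eig_last: "cutoff_eig E (CARD('n)) = sqrt (real m) / 2"
proof (rule cutoff_eig_eqI, rule tendsto_sandwich[where f = "\<lambda>_. sqrt (real m) / 2"])
  let ?K = "\<lambda>p. ((1 + real m powr (1/(p-1))) / 2) powr (p - 1) / 2"
  have up: "2 powr (-p) * var_eigenvalue E CARD('n) p \<le> ?K p" if p: "p \<ge> 2" for p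
  proof -
    define u where "u = real m powr (1/(p-1))"
    have u: "u > 0" "u powr (p - 1) = real m"
      using m p by (auto simp: u_def powr_powr)
    \<comment> \<open>This weight makes both coefficients of \<open>powr_add_le_weighted\<close>, summed over the leaves, equal.\<close>
    define \<theta> where "\<theta> = u / (1 + u)"
    have \<theta>: "0 < \<theta>" "\<theta> < 1" "1 - \<theta> = 1 / (1 + u)"
      using u by (auto simp: \<theta>_def field_simps)
    have inv: "x powr (1 - p) = 1 / x powr (p - 1)" for x :: real
      using powr_minus_divide[of x "p - 1"] by simp
    have c1: "(1 - \<theta>) powr (1 - p) = (1 + u) powr (p - 1)"
      unfolding \<theta>(3) inv using u by (simp add: powr_divide)
    have c2: "real m * \<theta> powr (1 - p) = (1 + u) powr (p - 1)"
      unfolding \<theta>_def inv using u m by (simp add: powr_divide)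
    have "var_eigenvalue E CARD('n) p \<le> (1 + u) powr (p - 1)"
    proof (rule var_eigenvalue_le[OF p_sphere_in_genus_family])
      fix f :: "real^'n" assume f: "f \<in> p_sphere p"
      have "rayleigh E p f = (\<Sum>s\<in>S. \<bar>f$c - f$s\<bar> powr p)"
        by (rule star_rayleigh[OF f])
      also have "\<dots> \<le> (\<Sum>s\<in>S. (\<bar>f$c\<bar> + \<bar>f$s\<bar>) powr p)"
        using p by (intro sum_mono powr_mono2) auto
      also have "\<dots> \<le> (\<Sum>s\<in>S. \<theta> powr (1 - p) * \<bar>f$c\<bar> powr p + (1 - \<theta>) powr (1 - p) * \<bar>f$s\<bar> powr p)"
        using p \<theta> by (intro sum_mono powr_add_le_weighted) auto
      also have "\<dots> = (1 + u) powr (p - 1) * (\<bar>f$c\<bar> powr p + (\<Sum>s\<in>S. \<bar>f$s\<bar> powr p))"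
        unfolding c1 by (simp add: sum.distrib cardS mult.assoc[symmetric] c2 distrib_left
            flip: sum_distrib_left)
      also have "\<dots> = (1 + u) powr (p - 1) * (\<Sum>s\<in>insert c S. \<bar>f$s\<bar> powr p)"
        using cS by simp
      also have "\<dots> \<le> (1 + u) powr (p - 1) * (\<Sum>s\<in>UNIV. \<bar>f$s\<bar> powr p)"
        by (intro mult_left_mono sum_mono2) auto
      finally show "rayleigh E p f \<le> (1 + u) powr (p - 1)"
        using f by (simp add: p_sphere_def)
    qed (use p in auto)
    then have "2 powr (-p) * var_eigenvalue E CARD('n) p \<le> 2 powr (-p) * (1 + u) powr (p - 1)"
      by (intro mult_left_mono) auto
    also have "\<dots> = ?K p"
      using u unfolding u_def[symmetric] by (simp add: powr_divide powr_minus powr_diff[of 2] field_simps)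
    finally show ?thesis .
  qed
  then show "\<forall>\<^sub>F p in at_top. 2 powr (-p) * var_eigenvalue E CARD('n) p \<le> ?K p"
    by (auto intro: eventually_at_top_linorderI[of 2])
  show "(?K \<longlongrightarrow> sqrt (real m) / 2) at_top"
    using m by (intro star_constant_tendsto) simp
  have low: "sqrt (real m) / 2 \<le> 2 powr (-p) * var_eigenvalue E CARD('n) p" if p: "p \<ge> 1" for p
  proof -
    \<comment> \<open>The unit eigenvector of the adjacency matrix of the star for its least
      eigenvalue \<open>- sqrt m\<close>: half of the mass sits at the centre, half on the
      leaves.\<close>
    define y :: "real^'n" where
      "y = (\<chi> i. if i = c then 1 / sqrt 2 else if i \<in> S then - 1 / sqrt (2 * real m) else 0)"
    have "(\<Sum>i\<in>UNIV. \<bar>y $ i\<bar> powr 2) = (\<Sum>i\<in>UNIV. (y $ i)\<^sup>2)" by simp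
    also have "\<dots> = (\<Sum>i\<in>insert c S. (y $ i)\<^sup>2)"
      by (rule sum.mono_neutral_right) (auto simp: y_def)
    also have "\<dots> = 1/2 + (\<Sum>i\<in>S. 1 / (2 * real m))"
    proof -
      have "(\<Sum>i\<in>S. (y $ i)\<^sup>2) = (\<Sum>i\<in>S. 1 / (2 * real m))"
        by (rule sum.cong) (use cS in \<open>auto simp: y_def power_divide\<close>)
      moreover have "(y $ c)\<^sup>2 = 1/2" by (simp add: y_def power_divide)
      ultimately show ?thesis using cS by simp
    qed
    also have "\<dots> = 1" using m by (simp add: cardS)
    finally have y: "y \<in> p_sphere 2" by (simp add: p_sphere_def)
    \<comment> \<open>The inverse substitution, so that \<open>rayleigh_ge\<close> at
      \<open>f\<close> becomes the quadratic form at \<open>y\<close>.\<close>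
    define f where "f = vspow (2/p) y"
    have f: "f \<in> p_sphere p" using vspow_in_p_sphere[OF y, of p] p by (simp add: f_def)
    have fy: "spow (p/2) (f $ i) = y $ i" for i
      using spow_spow_inverse[of "p/2" "y $ i"] p by (simp add: f_def)
    have "- (\<Sum>(i,j)\<in>E. y $ i * y $ j) / 2 = - (\<Sum>s\<in>S. y $ c * y $ s + y $ s * y $ c) / 2"
      unfolding E by (simp only: sum_star_edges[OF cS])
    also have "(\<Sum>s\<in>S. y $ c * y $ s + y $ s * y $ c) = (\<Sum>s\<in>S. - 1 / sqrt (real m))"
    proof (rule sum.cong)
      fix s assume "s \<in> S"
      then have "y $ c * y $ s = - 1 / (2 * sqrt (real m))"
        using cS by (auto simp: y_def real_sqrt_mult)
      then show "y $ c * y $ s + y $ s * y $ c = - 1 / sqrt (real m)"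
        by (simp add: mult.commute[of "y $ s"])
    qed simp
    also have "- (\<Sum>s\<in>S. - 1 / sqrt (real m)) / 2 = sqrt (real m) / 2"
      using m by (simp add: cardS real_div_sqrt)
    finally have "sqrt (real m) / 2 \<le> 2 powr (-p) * rayleigh E p f"
      using rayleigh_ge[OF f, of E E] p by (simp add: fy)
    then have ge: "2 powr p * (sqrt (real m) / 2) \<le> rayleigh E p f"
      by (simp add: powr_minus field_simps)
    have "2 powr p * (sqrt (real m) / 2) \<le> var_eigenvalue E CARD('n) p"
    proof (rule var_eigenvalue_ge)
      fix B :: "(real^'n) set" assume B: "B \<in> genus_family CARD('n) p"
      have "f \<in> B" by (rule genus_family_full[OF B _ f]) (use p in simp)
      then show "\<exists>f\<in>B. 2 powr p * (sqrt (real m) / 2) \<le> rayleigh E p f"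
        using ge by blast
    qed (use p in auto)
    then show ?thesis by (simp add: powr_minus field_simps)
  qed
  then show "\<forall>\<^sub>F p in at_top. sqrt (real m) / 2 \<le> 2 powr (-p) * var_eigenvalue E CARD('n) p"
    by (auto intro: eventually_at_top_linorderI[of 1])
qed simp

end

lemma cutoff_eig_empty:
  assumes "1 \<le> k" "k \<le> CARD('n)" shows "cutoff_eig ({} :: ('n::finite \<times> 'n) set) k = 0"
proof (rule cutoff_eig_eqI, rule tendsto_eventually)
  have "var_eigenvalue ({} :: ('n \<times> 'n) set) k p = 0" if "p \<ge> 1" for p
  proof (rule antisym)
    show "var_eigenvalue ({} :: ('n \<times> 'n) set) k p \<le> 0"
      using that assms
      by (intro var_eigenvalue_le[OF p_sphere_in_genus_family]) (auto simp: rayleigh_def)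
    show "0 \<le> var_eigenvalue ({} :: ('n \<times> 'n) set) k p"
      using that assms by (intro var_eigenvalue_nonneg) auto
  qed
  then show "\<forall>\<^sub>F p in at_top. 2 powr (-p) * var_eigenvalue ({} :: ('n \<times> 'n) set) k p = 0"
    by (auto intro: eventually_at_top_linorderI[of 1])
qed

theorem theorem8p9:
  fixes E :: "('n::finite \<times> 'n) set" and C :: real
  assumes "simple_graph E" and "C > 0"
  shows "((\<forall>k\<in>{1..<CARD('n)}. cutoff_eig E k = 0) \<and> cutoff_eig E (CARD('n)) = C)
         \<longleftrightarrow> (\<exists>m. real m = 4 * C^2 \<and> star_plus_isolated E m)"
proof
  assume L: "(\<forall>k\<in>{1..<CARD('n)}. cutoff_eig E k = 0) \<and> cutoff_eig E (CARD('n)) = C"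
  \<comment> \<open>Without edges the last cut-off eigenvalue would be \<open>0\<close> instead of
    \<open>C > 0\<close>.\<close>
  have "E \<noteq> {}"
    using L assms(2) cutoff_eig_empty[where 'n='n, of "CARD('n)"] by (auto simp: Suc_le_eq)
  then obtain a b where "(a, b) \<in> E" by auto
  then have "a \<noteq> b" using assms(1) by (auto simp: simple_graph_def irrefl_def)
  then have "2 \<le> CARD('n)"
    using card_mono[of "UNIV :: 'n set" "{a,b}"] by simp
  \<comment> \<open>With at least two vertices, \<open>CARD('n) - 1\<close> is one of the indices
    whose eigenvalue is assumed to vanish.\<close>
  then have zero: "\<not> 1/2 \<le> cutoff_eig E (CARD('n) - 1)"
    using L by auto
  have "\<exists>m. star_plus_isolated E m"
  proof (rule intersecting_edges_star[OF assms(1) \<open>E \<noteq> {}\<close>])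
    show "\<not> distinct [a, b, c, d]" if "{(a,b), (b,a), (c,d), (d,c)} \<subseteq> E" for a b c d
      using cutoff_eig_ge_half_of_disjoint_edges[OF that] zero by blast
    show "\<not> distinct [a, b, c]" if "{(a,b), (b,a), (b,c), (c,b), (a,c), (c,a)} \<subseteq> E" for a b c
      using cutoff_eig_ge_half_of_triangle[OF that] zero by blast
  qed
  then obtain m where m: "star_plus_isolated E m" by blast
  then obtain c S where "c \<notin> S" "card S = m" "m \<ge> 1"
    "E = {(c,s) | s. s \<in> S} \<union> {(s,c) | s. s \<in> S}"
    unfolding star_plus_isolated_def by blast
  \<comment> \<open>The last eigenvalue determines the number of leaves.\<close>
  from star_cutoff_eig_last[OF this] L have "sqrt (real m) / 2 = C" by simp
  then have "real m = 4 * C^2"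
    using real_sqrt_pow2[of "real m"] by (auto simp: power_divide)
  with m show "\<exists>m. real m = 4 * C^2 \<and> star_plus_isolated E m" by blast
next
  assume "\<exists>m. real m = 4 * C^2 \<and> star_plus_isolated E m"
  then obtain m c S where m: "real m = 4 * C^2" "m \<ge> 1" "c \<notin> S" "card S = m"
    "E = {(c,s) | s. s \<in> S} \<union> {(s,c) | s. s \<in> S}"
    unfolding star_plus_isolated_def by blast
  have "sqrt (real m) / 2 = C"
    using m(1) assms(2) by (simp add: real_sqrt_mult)
  then show "(\<forall>k\<in>{1..<CARD('n)}. cutoff_eig E k = 0) \<and> cutoff_eig E (CARD('n)) = C"
    using star_cutoff_eig_last[OF m(3,4,2,5)] star_cutoff_eig_eq_0[OF m(3,4,2,5)] by auto
qed

end
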